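(* Let $C_n$ be the cycle on $n\geq 4$ vertices and consider two cops chasing an invisible robber. Then \[\frac{n}{4}\left(1-O\left(\frac{\log n}{n}\right)\right)\leq \mathrm{idct}(C_n)\leq \frac{n-1}{4}.\] In particular $\mathrm{idct}(C_n)=(1+o(1))n/4$ and the cost of drunkenness for the invisible robber is $F_i(C_n)=\mathrm{ict}(C_n)/\mathrm{idct}(C_n)=2+o(1)$, where asymptotics are as $n\to\infty$.
   Context: The cop number of the cycle is $c(C_n)=2$. Invisible robber games on a graph $G=(V,E)$ with $k$ cops: the cops choose initial positions $x\in V^k$, then the robber's initial vertex is chosen; in each round first each cop moves along an edge or stays, then the robber moves. The robber is invisible: the cops do not know his position until capture, so their (possibly randomized) strategy cannot depend on the robber's positions. The capture time is the first time a cop and the robber occupy the same vertex. Adversarial version: the robber chooses his initial vertex $y$ and his moves (he may stay put) to maximize capture time; $\mathrm{ict}_{x,y}(G,k)$ is the expected capture time from $(x,y)$ when both cops and robber play optimally, $\mathrm{ict}(G,k)=\min_{x}\max_{y}\mathrm{ict}_{x,y}(G,k)$, and $\mathrm{ict}(G)=\mathrm{ict}(G,c(G))$. Drunk version: the robber's initial vertex is uniformly random in $V$ and in each round he moves to a uniformly random neighbour of his current vertex (open neighbourhood), independently of the cops; $\mathrm{idct}_x(G,k)$ is the smallest expected capture time achievable by the cops from $x$, $\mathrm{idct}(G,k)=\min_{x}\mathrm{idct}_x(G,k)$, $\mathrm{idct}(G)=\mathrm{idct}(G,c(G))$. The cost of drunkenness for the invisible robber is $F_i(G)=\mathrm{ict}(G)/\mathrm{idct}(G)$.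 *)

theory Defs
  imports "HOL-Probability.Probability" "HOL-Library.Landau_Symbols"
begin

section \<open>Graphs, configurations and moves\<close>

text \<open>A graph is a pair of a vertex set and a set of two-element edges.\<close>

type_synonym 'v graph = "'v set \<times> 'v set set"

abbreviation verts :: "'v graph \<Rightarrow> 'v set" where
  "verts G \<equiv> fst G"

abbreviation edges :: "'v graph \<Rightarrow> 'v set set" where
  "edges G \<equiv> snd G"

definition nbhd :: "'v graph \<Rightarrow> 'v \<Rightarrow> 'v set" where
  "nbhd G v = {w. {v, w} \<in> edges G}"

definition cycle_graph :: "nat \<Rightarrow> nat graph" where
  "cycle_graph n = ({..<n}, (\<lambda>i. {i, (i + 1) mod n}) ` {..<n})"

text \<open>Configurations of \<open>k\<close> cops are tuples in \<open>V\<^sup>k\<close>, represented as lists; several cops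
  may share a vertex.\<close>

definition placements :: "'v graph \<Rightarrow> nat \<Rightarrow> 'v list set" where
  "placements G k = {xs. length xs = k \<and> set xs \<subseteq> verts G}"

definition moves :: "'v graph \<Rightarrow> 'v \<Rightarrow> 'v set" where
  "moves G v = insert v (nbhd G v)"

definition cop_moves :: "'v graph \<Rightarrow> 'v list \<Rightarrow> 'v list set" where
  "cop_moves G xs = {xs'. list_all2 (\<lambda>u u'. u' \<in> moves G u) xs xs'}"


section \<open>The cop number\<close>

text \<open>The classical game with a visible robber: \<open>cops_win G xs y\<close> says that the cops, about to
  move from \<open>xs\<close> against a robber at \<open>y\<close>, can force a capture after finitely many rounds.\<close>

inductive cops_win :: "'v graph \<Rightarrow> 'v list \<Rightarrow> 'v \<Rightarrow> bool" for G where
  caught: "y \<in> set xs \<Longrightarrow> cops_win G xs y"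
| catch: "xs' \<in> cop_moves G xs \<Longrightarrow> y \<in> set xs' \<Longrightarrow> cops_win G xs y"
| step: "xs' \<in> cop_moves G xs \<Longrightarrow> (\<And>y'. y' \<in> moves G y \<Longrightarrow> cops_win G xs' y') \<Longrightarrow> cops_win G xs y"

definition cop_number :: "'v graph \<Rightarrow> nat" where
  "cop_number G = (LEAST k. \<exists>xs\<in>placements G k. \<forall>y\<in>verts G. cops_win G xs y)"


section \<open>Plays against an invisible robber\<close>

text \<open>Behaviour strategies. The cops never observe the robber, so their next move depends only on
  the (nonempty) list of their own configurations so far, and on their randomisation. The robber
  sees the cops: his move in round \<open>t + 1\<close> depends on the cop configurations
  \<open>[x\<^sub>0, \<dots>, x\<^sub>t\<^sub>+\<^sub>1]\<close>, including the cop move just made, and on his own positions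
  \<open>[y\<^sub>0, \<dots>, y\<^sub>t]\<close>.\<close>

type_synonym 'v cop_strategy = "'v list list \<Rightarrow> 'v list pmf"

type_synonym 'v robber_strategy = "'v list list \<Rightarrow> 'v list \<Rightarrow> 'v pmf"

definition cop_strategies :: "'v graph \<Rightarrow> 'v cop_strategy set" where
  "cop_strategies G = {\<sigma>. \<forall>X. X \<noteq> [] \<longrightarrow> set_pmf (\<sigma> X) \<subseteq> cop_moves G (last X)}"

definition robber_strategies :: "'v graph \<Rightarrow> 'v robber_strategy set" where
  "robber_strategies G = {\<rho>. \<forall>X Y. Y \<noteq> [] \<longrightarrow> set_pmf (\<rho> X Y) \<subseteq> moves G (last Y)}"

text \<open>The drunk robber: simple random walk (on the open neighbourhood).\<close>

definition drunk :: "'v graph \<Rightarrow> 'v robber_strategy" where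
  "drunk G X Y = pmf_of_set (nbhd G (last Y))"

text \<open>\<open>round_pmf \<sigma> \<rho> \<mu> h\<close> is the conditional law of the next pair (cops, robber) of positions
  given the list \<open>h\<close> of all previous pairs; \<open>\<mu>\<close> is the law of the initial pair.\<close>

definition round_pmf ::
  "'v cop_strategy \<Rightarrow> 'v robber_strategy \<Rightarrow> ('v list \<times> 'v) pmf \<Rightarrow> ('v list \<times> 'v) list
     \<Rightarrow> ('v list \<times> 'v) pmf" where
  "round_pmf \<sigma> \<rho> \<mu> h =
     (if h = [] then \<mu>
      else bind_pmf (\<sigma> (map fst h)) (\<lambda>x. map_pmf (Pair x) (\<rho> (map fst h @ [x]) (map snd h))))"

definition round_kernel ::
  "'v cop_strategy \<Rightarrow> 'v robber_strategy \<Rightarrow> ('v list \<times> 'v) pmf \<Rightarrow> nat \<Rightarrow> (nat \<Rightarrow> 'v list \<times> 'v)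
     \<Rightarrow> ('v list \<times> 'v) measure" where
  "round_kernel \<sigma> \<rho> \<mu> t \<omega> = measure_pmf (round_pmf \<sigma> \<rho> \<mu> (map \<omega> [0..<t]))"

lemma Ionescu_Tulcea_round_kernel:
  fixes \<sigma> :: "'v :: countable cop_strategy"
  shows "Ionescu_Tulcea (round_kernel \<sigma> \<rho> \<mu>) (\<lambda>_. count_space UNIV)"
proof (rule Ionescu_Tulcea.intro)
  fix t :: nat
  let ?M = "PiM {0..<t} (\<lambda>_. count_space (UNIV :: ('v list \<times> 'v) set))"
  have "(\<lambda>\<omega>. map \<omega> [0..<t]) \<in> measurable ?M (count_space UNIV)"
  proof (subst measurable_count_space_eq_countable, simp, intro conjI ballI)
    fix h :: "('v list \<times> 'v) list"
    have "Measurable.pred ?M (\<lambda>\<omega>. \<omega> i = h ! i)" if "i \<in> {0..<t}" for i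
      using measurable_compose[OF measurable_component_singleton[OF that]
          measurable_count_space, of "\<lambda>x. x = h ! i"] by simp
    then have "Measurable.pred ?M (\<lambda>\<omega>. length h = t \<and> (\<forall>i\<in>{0..<t}. \<omega> i = h ! i))"
      by (intro pred_intros_logic pred_intros_finite) auto
    moreover have "map \<omega> [0..<t] = h \<longleftrightarrow> length h = t \<and> (\<forall>i\<in>{0..<t}. \<omega> i = h ! i)"
      for \<omega> :: "nat \<Rightarrow> 'v list \<times> 'v"
      unfolding list_eq_iff_nth_eq by auto
    then have "(\<lambda>\<omega>. map \<omega> [0..<t]) -` {h} \<inter> space ?M
        = {\<omega> \<in> space ?M. length h = t \<and> (\<forall>i\<in>{0..<t}. \<omega> i = h ! i)}"
      by blast
    ultimately show "(\<lambda>\<omega>. map \<omega> [0..<t]) -` {h} \<inter> space ?M \<in> sets ?M"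
      by (simp add: pred_def)
  qed auto
  moreover have "(\<lambda>h. measure_pmf (round_pmf \<sigma> \<rho> \<mu> h))
      \<in> measurable (count_space UNIV) (subprob_algebra (count_space UNIV))"
    by (rule measurable_measure_pmf)
  ultimately show "round_kernel \<sigma> \<rho> \<mu> t \<in> measurable ?M (subprob_algebra (count_space UNIV))"
    unfolding round_kernel_def by (rule measurable_compose)
qed (simp add: round_kernel_def prob_space_measure_pmf)

text \<open>The law of the infinite play on the product space, by the Ionescu-Tulcea theorem.\<close>

definition play ::
  "'v cop_strategy \<Rightarrow> 'v robber_strategy \<Rightarrow> ('v list \<times> 'v) pmf
     \<Rightarrow> (nat \<Rightarrow> 'v list \<times> 'v) measure" where
  "play \<sigma> \<rho> \<mu> = projective_family.lim UNIV
     (Ionescu_Tulcea.CI (round_kernel \<sigma> \<rho> \<mu>) (\<lambda>_. count_space UNIV)) (\<lambda>_. count_space UNIV)"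

lemma distr_play:
  fixes \<sigma> :: "'v :: countable cop_strategy"
  assumes "finite J"
  shows "distr (play \<sigma> \<rho> \<mu>) (PiM J (\<lambda>_. count_space UNIV)) (\<lambda>\<omega>. restrict \<omega> J)
    = Ionescu_Tulcea.CI (round_kernel \<sigma> \<rho> \<mu>) (\<lambda>_. count_space UNIV) J"
  unfolding play_def
  by (rule Ionescu_Tulcea.distr_lim[OF Ionescu_Tulcea_round_kernel assms])

text \<open>With \<open>\<omega> t = (x\<^sub>t, y\<^sub>t)\<close>, the robber is caught in round \<open>t\<close> if a cop moves onto him
  (\<open>y\<^sub>t\<^sub>-\<^sub>1\<close> occurs in \<open>x\<^sub>t\<close>) or if he moves onto a cop (\<open>y\<^sub>t\<close> occurs in \<open>x\<^sub>t\<close>). What happens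
  in \<open>\<omega>\<close> after the first capture is irrelevant.\<close>

definition captured :: "(nat \<Rightarrow> 'v list \<times> 'v) \<Rightarrow> nat \<Rightarrow> bool" where
  "captured \<omega> t \<longleftrightarrow> snd (\<omega> t) \<in> set (fst (\<omega> t))
     \<or> (0 < t \<and> snd (\<omega> (t - 1)) \<in> set (fst (\<omega> t)))"

definition capture_time :: "(nat \<Rightarrow> 'v list \<times> 'v) \<Rightarrow> enat" where
  "capture_time \<omega> = (INF t\<in>{t. captured \<omega> t}. enat t)"

definition expected_capture_time ::
  "'v cop_strategy \<Rightarrow> 'v robber_strategy \<Rightarrow> ('v list \<times> 'v) pmf \<Rightarrow> ennreal" where
  "expected_capture_time \<sigma> \<rho> \<mu> = (\<integral>\<^sup>+\<omega>. ennreal_of_enat (capture_time \<omega>) \<partial>play \<sigma> \<rho> \<mu>)"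


section \<open>Capture times and the cost of drunkenness\<close>

text \<open>Adversarial robber. \<open>ict_against G \<sigma> x y\<close> is the expected capture time from \<open>(x, y)\<close> when the
  robber plays optimally against \<open>\<sigma>\<close>. The cops do not know \<open>y\<close> either, so a single strategy has to
  be optimal against the robber's choice of \<open>y\<close>: the infimum over \<open>\<sigma>\<close> stands outside the supremum
  over \<open>y\<close>.\<close>

definition ict_against :: "'v graph \<Rightarrow> 'v cop_strategy \<Rightarrow> 'v list \<Rightarrow> 'v \<Rightarrow> ennreal" where
  "ict_against G \<sigma> x y = (SUP \<rho>\<in>robber_strategies G. expected_capture_time \<sigma> \<rho> (return_pmf (x, y)))"

definition ict_from :: "'v graph \<Rightarrow> 'v list \<Rightarrow> ennreal" where
  "ict_from G x = (INF \<sigma>\<in>cop_strategies G. SUP y\<in>verts G. ict_against G \<sigma> x y)"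

definition ict_cops :: "'v graph \<Rightarrow> nat \<Rightarrow> ennreal" where
  "ict_cops G k = (INF x\<in>placements G k. ict_from G x)"

definition ict :: "'v graph \<Rightarrow> ennreal" where
  "ict G = ict_cops G (cop_number G)"

text \<open>Drunk robber.\<close>

definition idct_from :: "'v graph \<Rightarrow> 'v list \<Rightarrow> ennreal" where
  "idct_from G x = (INF \<sigma>\<in>cop_strategies G.
     expected_capture_time \<sigma> (drunk G) (map_pmf (Pair x) (pmf_of_set (verts G))))"

definition idct_cops :: "'v graph \<Rightarrow> nat \<Rightarrow> ennreal" where
  "idct_cops G k = (INF x\<in>placements G k. idct_from G x)"

definition idct :: "'v graph \<Rightarrow> ennreal" where
  "idct G = idct_cops G (cop_number G)"

definition cost_of_drunkenness :: "'v graph \<Rightarrow> ennreal" where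
  "cost_of_drunkenness G = ict G / idct G"

end

theory Submission
  imports Defs
begin

text \<open>Two cops sweeping the cycle in opposite directions from adjacent vertices confine the robber
  after round \<open>t\<close> to \<open>n - 2 - 2 t\<close> vertices. This catches any robber within \<open>n / 2\<close> rounds, and
  since the drunk robber is uniformly distributed at all times, it catches him in expected time at
  most \<open>(n - 1) / 4\<close>.

  Conversely, for a fixed cop trajectory \<open>x\<close> and a fixed walk \<open>S\<close>, the initial vertices from which
  the drunk robber is caught by round \<open>t\<close> correspond to the range of \<open>x - S\<close>, up to two more points.
  A Doob type estimate bounds the expected range by \<open>t + 20\<close> for every trajectory of speed at
  most one, so the robber is uncaught after round \<open>t\<close> with probability at least
  \<open>1 - (2 t + 46) / n\<close>. Summing over \<open>t < n / 2\<close> gives \<open>idct \<ge> n / 4 - 23\<close>.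

  The adversarial robber picks one of the two arcs between the cops with probability proportional
  to its length and keeps away from the cops. An arc shrinks by at most two vertices per round, and
  when one of them has collapsed the other has length about \<open>n\<close>; this gives
  \<open>ict \<ge> n / 2 - 5\<close>.\<close>

section \<open>Finite prefixes of a play\<close>

text \<open>The range bound has to be \<open>t\<close> plus a constant. Bounding trajectory and walk
  separately gives \<open>t\<close> plus order sqrt t; summed over \<open>t < n / 2\<close> and
  divided by \<open>n\<close>, that error costs order sqrt n in \<open>idct\<close>, which is too
  much for a relative error \<open>ln n / n\<close>. But the two contributions cannot both be large.
  A cop that makes at most four fifths of its moves in each direction spans at most
  \<open>4 / 5 * t\<close>, and the slack \<open>t / 5\<close> absorbs the fluctuation of the walk.
  In the rounds in which a cop keeps its main direction, the relative step is 0 or 2 in that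
  direction; if these rounds prevail, the relative walk is almost monotone and its range is close to
  its displacement, whose mean contains no square root.

  Invisibility enters as independence: the cop trajectory can be fixed before the start and the
  steps of the drunk robber are drawn, and the law of the trajectory is the same for every robber.
  Hence the adversary needs no random start: the better of two starting vertices does at least as
  well as their weighted average.\<close>

primrec prefix_pmf ::
  "'v cop_strategy \<Rightarrow> 'v robber_strategy \<Rightarrow> ('v list \<times> 'v) pmf \<Rightarrow> nat
     \<Rightarrow> ('v list \<times> 'v) list pmf" where
  "prefix_pmf \<sigma> \<rho> \<mu> 0 = return_pmf []"
| "prefix_pmf \<sigma> \<rho> \<mu> (Suc t) =
     bind_pmf (prefix_pmf \<sigma> \<rho> \<mu> t) (\<lambda>h. map_pmf (\<lambda>z. h @ [z]) (round_pmf \<sigma> \<rho> \<mu> h))"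

lemma length_prefix_pmf: "h \<in> set_pmf (prefix_pmf \<sigma> \<rho> \<mu> t) \<Longrightarrow> length h = t"
  by (induction t arbitrary: h) auto

lemma measurable_map_upt:
  assumes "{0..<t} \<subseteq> I"
  shows "(\<lambda>\<omega>. map \<omega> [0..<t]) \<in> measurable (PiM I (\<lambda>_. count_space UNIV))
     (count_space (UNIV :: 'a::countable list set))"
proof (subst measurable_count_space_eq_countable, simp, intro conjI ballI)
  fix h :: "'a list"
  let ?M = "PiM I (\<lambda>_. count_space (UNIV :: 'a set))"
  have "Measurable.pred ?M (\<lambda>\<omega>. \<omega> i = h ! i)" if "i \<in> {0..<t}" for i
    using measurable_compose[OF measurable_component_singleton[of i I]
        measurable_count_space, of "\<lambda>x. x = h ! i"] that assms by auto
  then have pred: "Measurable.pred ?M (\<lambda>\<omega>. length h = t \<and> (\<forall>i\<in>{0..<t}. \<omega> i = h ! i))"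
    by (intro pred_intros_logic pred_intros_finite) auto
  have "map \<omega> [0..<t] = h \<longleftrightarrow> length h = t \<and> (\<forall>i\<in>{0..<t}. \<omega> i = h ! i)"
    for \<omega> :: "nat \<Rightarrow> 'a"
    unfolding list_eq_iff_nth_eq by auto
  then have "(\<lambda>\<omega>. map \<omega> [0..<t]) -` {h} \<inter> space ?M
      = {\<omega> \<in> space ?M. length h = t \<and> (\<forall>i\<in>{0..<t}. \<omega> i = h ! i)}"
    by blast
  with pred show "(\<lambda>\<omega>. map \<omega> [0..<t]) -` {h} \<inter> space ?M \<in> sets ?M"
    by (simp only: pred_def)
qed auto

lemma sets_play:
  fixes \<sigma> :: "'v :: countable cop_strategy"
  shows "sets (play \<sigma> \<rho> \<mu>) = sets (PiM UNIV (\<lambda>_. count_space UNIV))"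
proof -
  interpret Ionescu_Tulcea "round_kernel \<sigma> \<rho> \<mu>" "\<lambda>_. count_space UNIV"
    by (rule Ionescu_Tulcea_round_kernel)
  show ?thesis unfolding play_def by (rule PF.sets_lim)
qed

text \<open>The kernel composition \<open>C 0 t\<close> and \<open>prefix_pmf\<close> obey the same
  recursion, and the projective limit has \<open>C 0 t\<close> as its marginal on the first
  \<open>t\<close> coordinates. From here on only discrete laws of finite histories are
  needed.\<close>

lemma nn_integral_play_prefix:
  fixes \<sigma> :: "'v :: countable cop_strategy" and f :: "('v list \<times> 'v) list \<Rightarrow> ennreal"
  shows "(\<integral>\<^sup>+\<omega>. f (map \<omega> [0..<t]) \<partial>play \<sigma> \<rho> \<mu>) = (\<integral>\<^sup>+h. f h \<partial>measure_pmf (prefix_pmf \<sigma> \<rho> \<mu> t))"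
proof -
  interpret Ionescu_Tulcea "round_kernel \<sigma> \<rho> \<mu>" "\<lambda>_. count_space UNIV"
    by (rule Ionescu_Tulcea_round_kernel)
  let ?M = "\<lambda>t. PiM {0..<t} (\<lambda>_. count_space (UNIV :: ('v list \<times> 'v) set))"
  let ?C = "\<lambda>t. C 0 t (\<lambda>x. undefined)"
  have sp: "(\<lambda>x. undefined) \<in> space (?M 0)" by (auto simp: space_PiM PiE_iff extensional_def)
  have sets_C0: "sets (?C t) = sets (?M t)" for t
    using sets_C[OF sp, of t] by simp
  have map_measurable: "(\<lambda>\<omega>. f (map \<omega> [0..<t])) \<in> borel_measurable (?M t)"
    for t and f :: "('v list \<times> 'v) list \<Rightarrow> ennreal"
    by (rule measurable_compose[OF measurable_map_upt]) auto
  have C: "(\<integral>\<^sup>+\<omega>. f (map \<omega> [0..<t]) \<partial>?C t) = (\<integral>\<^sup>+h. f h \<partial>measure_pmf (prefix_pmf \<sigma> \<rho> \<mu> t))"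
    for t and f :: "('v list \<times> 'v) list \<Rightarrow> ennreal"
  proof (induction t arbitrary: f)
    case 0
    show ?case
      unfolding C.simps by (subst nn_integral_return[OF sp map_measurable]) simp
  next
    case (Suc t)
    have eP: "eP t \<in> measurable (?C t) (subprob_algebra (?M (Suc t)))"
      using measurable_eP[of t] by (simp add: measurable_cong_sets[OF sets_C0 refl])
    have "(\<integral>\<^sup>+\<omega>. f (map \<omega> [0..<Suc t]) \<partial>?C (Suc t)) =
        (\<integral>\<^sup>+\<omega>'. (\<integral>\<^sup>+\<omega>. f (map \<omega> [0..<Suc t]) \<partial>eP t \<omega>') \<partial>?C t)"
      unfolding C.simps add_0 by (rule nn_integral_bind[OF map_measurable eP])
    also have "\<dots> = (\<integral>\<^sup>+\<omega>'. (\<integral>\<^sup>+z. f (map \<omega>' [0..<t] @ [z])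
        \<partial>measure_pmf (round_pmf \<sigma> \<rho> \<mu> (map \<omega>' [0..<t]))) \<partial>?C t)"
    proof (rule nn_integral_cong)
      fix \<omega>' assume "\<omega>' \<in> space (?C t)"
      then have sp': "\<omega>' \<in> space (?M t)"
        using sets_eq_imp_space_eq[OF sets_C0] by simp
      have "(\<integral>\<^sup>+\<omega>. f (map \<omega> [0..<Suc t]) \<partial>eP t \<omega>')
          = (\<integral>\<^sup>+z. f (map (\<omega>'(t := z)) [0..<Suc t]) \<partial>round_kernel \<sigma> \<rho> \<mu> t \<omega>')"
        by (rule nn_integral_eP[OF sp' map_measurable])
      also have "\<dots> = (\<integral>\<^sup>+z. f (map \<omega>' [0..<t] @ [z]) \<partial>round_kernel \<sigma> \<rho> \<mu> t \<omega>')"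
        by (intro nn_integral_cong arg_cong[where f=f]) auto
      finally show "(\<integral>\<^sup>+\<omega>. f (map \<omega> [0..<Suc t]) \<partial>eP t \<omega>') =
          (\<integral>\<^sup>+z. f (map \<omega>' [0..<t] @ [z]) \<partial>measure_pmf (round_pmf \<sigma> \<rho> \<mu> (map \<omega>' [0..<t])))"
        by (simp add: round_kernel_def)
    qed
    also have "\<dots> = (\<integral>\<^sup>+h. (\<integral>\<^sup>+z. f (h @ [z]) \<partial>measure_pmf (round_pmf \<sigma> \<rho> \<mu> h))
        \<partial>measure_pmf (prefix_pmf \<sigma> \<rho> \<mu> t))"
      by (rule Suc.IH)
    also have "\<dots> = (\<integral>\<^sup>+h. f h \<partial>measure_pmf (prefix_pmf \<sigma> \<rho> \<mu> (Suc t)))"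
      by simp
    finally show ?case .
  qed
  \<comment> \<open>\<open>CI J\<close> restricts \<open>C 0 (up_to J)\<close> to \<open>J\<close>,
    where \<open>up_to J\<close> is the least bound of the index set.\<close>
  have up: "up_to {0..<t} = t"
    using up_to[of "{0..<t}"] up_to_iff_Ico[of "{0..<t}" t] by auto
  have restrict: "(\<lambda>\<omega>. restrict \<omega> {0..<t}) \<in> measurable (play \<sigma> \<rho> \<mu>) (?M t)"
    unfolding measurable_cong_sets[OF sets_play refl] by (rule measurable_restrict_subset) simp
  have restrict_C: "(\<lambda>\<omega>. restrict \<omega> {0..<t}) \<in> measurable (?C t) (?M t)"
    unfolding measurable_cong_sets[OF sets_C0 refl] by (rule measurable_restrict_subset) simp
  have map_restrict: "map (restrict \<omega> {0..<t}) [0..<t] = map \<omega> [0..<t]"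
    for \<omega> :: "nat \<Rightarrow> 'v list \<times> 'v"
    by auto
  have "(\<integral>\<^sup>+\<omega>. f (map \<omega> [0..<t]) \<partial>play \<sigma> \<rho> \<mu>)
      = (\<integral>\<^sup>+\<omega>. f (map \<omega> [0..<t]) \<partial>distr (play \<sigma> \<rho> \<mu>) (?M t) (\<lambda>\<omega>. restrict \<omega> {0..<t}))"
    by (subst nn_integral_distr[OF restrict], simp add: map_measurable, simp only: map_restrict)
  also have "\<dots> = (\<integral>\<^sup>+\<omega>. f (map \<omega> [0..<t]) \<partial>?C t)"
    unfolding distr_play[OF finite_atLeastLessThan] CI_def up
    by (subst nn_integral_distr[OF restrict_C], simp add: map_measurable, simp only: map_restrict)
  finally show ?thesis using C by simp
qed

definition uncaught :: "('v list \<times> 'v) list \<Rightarrow> bool" where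
  "uncaught h \<longleftrightarrow> (\<forall>s<length h. snd (h ! s) \<notin> set (fst (h ! s))
     \<and> (0 < s \<longrightarrow> snd (h ! (s - 1)) \<notin> set (fst (h ! s))))"

lemma uncaught_single [simp]: "uncaught [(x, y)] \<longleftrightarrow> y \<notin> set x"
  by (simp add: uncaught_def)

lemma uncaught_snoc:
  "h \<noteq> [] \<Longrightarrow> uncaught (h @ [(x, y)]) \<longleftrightarrow>
     uncaught h \<and> y \<notin> set x \<and> snd (last h) \<notin> set x"
proof -
  assume "h \<noteq> []"
  then have "uncaught (h @ [(x, y)]) \<longleftrightarrow>
      ((\<forall>s<length h. snd (h ! s) \<notin> set (fst (h ! s))
        \<and> (0 < s \<longrightarrow> snd (h ! (s - 1)) \<notin> set (fst (h ! s))))) \<and> y \<notin> set x \<and> snd (last h) \<notin> set x"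
    unfolding uncaught_def by (simp add: nth_append last_conv_nth All_less_Suc less_imp_diff_less conj_ac)
  then show ?thesis by (simp only: uncaught_def)
qed

lemma capture_time_greater_iff: "enat t < capture_time \<omega> \<longleftrightarrow> uncaught (map \<omega> [0..<Suc t])"
proof -
  have "enat t < capture_time \<omega> \<longleftrightarrow> (\<forall>s\<le>t. \<not> captured \<omega> s)"
  proof (cases "\<exists>s. captured \<omega> s")
    case True
    define m where "m = (LEAST s. captured \<omega> s)"
    have m: "captured \<omega> m" "\<And>s. captured \<omega> s \<Longrightarrow> m \<le> s"
      using True unfolding m_def by (auto intro: LeastI Least_le)
    have "capture_time \<omega> = enat m"
      unfolding capture_time_def by (rule INF_eqI) (use m in auto)
    moreover have "t < m \<longleftrightarrow> (\<forall>s\<le>t. \<not> captured \<omega> s)"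
      using m by (meson le_trans not_le order_refl)
    ultimately show ?thesis by simp
  \<comment> \<open>Without any capture the infimum runs over the empty set and is infinite.\<close>
  qed (auto simp: capture_time_def top_enat_def)
  then show ?thesis
    by (auto simp: uncaught_def captured_def less_Suc_eq_le simp del: upt_Suc)
qed

text \<open>The tail formula for an expectation in \<open>enat\<close>. It reduces upper and lower
  bounds alike to survival probabilities; a prefix of length \<open>Suc t\<close> ends with round
  \<open>t\<close>.\<close>

lemma expected_capture_time_eq_suminf:
  fixes \<sigma> :: "'v :: countable cop_strategy"
  shows "expected_capture_time \<sigma> \<rho> \<mu> =
    (\<Sum>t. ennreal (measure_pmf.prob (prefix_pmf \<sigma> \<rho> \<mu> (Suc t)) {h. uncaught h}))"
proof -
  let ?P = "play \<sigma> \<rho> \<mu>"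
  have prefix: "(\<lambda>\<omega>. map \<omega> [0..<t]) \<in> measurable ?P (count_space UNIV)" for t
    unfolding measurable_cong_sets[OF sets_play refl] by (rule measurable_map_upt) simp
  have pred: "{\<omega> \<in> space ?P. uncaught (map \<omega> [0..<Suc t])} \<in> sets ?P" for t
    using measurable_compose[OF prefix measurable_count_space, of uncaught]
    by (simp add: pred_def del: upt_Suc)
  have "capture_time \<in> measurable ?P (count_space UNIV)"
  proof -
    have gt: "Measurable.pred ?P (\<lambda>\<omega>. enat t < capture_time \<omega>)" for t
      unfolding capture_time_greater_iff using pred by (simp add: pred_def del: upt_Suc)
    \<comment> \<open>An extended natural number is determined by the naturals below it, so
      measurability reduces to the events on prefixes.\<close>
    have eq: "capture_time \<omega> = e \<longleftrightarrow> (\<forall>t. enat t < capture_time \<omega> \<longleftrightarrow> enat t < e)" for \<omega> e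
      by (cases "capture_time \<omega>"; cases e) (simp_all, meson linorder_neq_iff, auto)
    have "Measurable.pred ?P (\<lambda>\<omega>. capture_time \<omega> = e)" for e
      unfolding eq by (intro pred_intros_countable pred_intros_logic gt) simp
    moreover have "capture_time -` {e} \<inter> space ?P = {\<omega> \<in> space ?P. capture_time \<omega> = e}" for e
      by auto
    ultimately show ?thesis
      by (subst measurable_count_space_eq_countable) (simp_all add: pred_def)
  qed
  then have "expected_capture_time \<sigma> \<rho> \<mu> = (\<Sum>t. emeasure ?P {\<omega> \<in> space ?P. enat t < capture_time \<omega>})"
    unfolding expected_capture_time_def by (rule nn_integral_enat_function)
  moreover have "emeasure ?P {\<omega> \<in> space ?P. enat t < capture_time \<omega>}
      = ennreal (measure_pmf.prob (prefix_pmf \<sigma> \<rho> \<mu> (Suc t)) {h. uncaught h})" for t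
  proof -
    have "emeasure ?P {\<omega> \<in> space ?P. enat t < capture_time \<omega>}
        = (\<integral>\<^sup>+\<omega>. indicator {h. uncaught h} (map \<omega> [0..<Suc t]) \<partial>?P)"
      unfolding capture_time_greater_iff
      by (subst nn_integral_indicator[OF pred, symmetric])
        (auto intro!: nn_integral_cong split: split_indicator)
    also have "\<dots> = emeasure (prefix_pmf \<sigma> \<rho> \<mu> (Suc t)) {h. uncaught h}"
      by (subst nn_integral_play_prefix) (simp del: prefix_pmf.simps)
    finally show ?thesis by (simp add: measure_pmf.emeasure_eq_measure)
  qed
  ultimately show ?thesis by simp
qed

section \<open>The cycle\<close>

text \<open>The covering map from the integer line to the cycle. Distances, gaps and displacements
  are computed on the line.\<close>

definition vx :: "nat \<Rightarrow> int \<Rightarrow> nat" where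
  "vx n z = nat (z mod int n)"

lemma vx_less: "0 < n \<Longrightarrow> vx n z < n"
  by (simp add: vx_def nat_less_iff)

lemma int_vx: "0 < n \<Longrightarrow> int (vx n z) = z mod int n"
  by (simp add: vx_def)

lemma vx_of_nat: "i < n \<Longrightarrow> vx n (int i) = i"
  by (simp add: vx_def)

lemma vx_eq_iff: "0 < n \<Longrightarrow> vx n a = vx n b \<longleftrightarrow> a mod int n = b mod int n"
  by (simp add: vx_def eq_nat_nat_iff)

lemma vx_add_cong: "vx n a = vx n b \<Longrightarrow> 0 < n \<Longrightarrow> vx n (a + c) = vx n (b + c)"
  unfolding vx_eq_iff by (rule mod_add_cong) simp_all

lemma vx_int_vx_add: "0 < n \<Longrightarrow> vx n (int (vx n z) + e) = vx n (z + e)"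
  by (simp add: vx_def mod_add_left_eq)

lemma vx_neq: "a < b \<Longrightarrow> b < a + int n \<Longrightarrow> vx n a \<noteq> vx n b"
proof
  assume ab: "a < b" "b < a + int n" and "vx n a = vx n b"
  then have "b mod int n = a mod int n" by (subst (asm) vx_eq_iff) auto
  then have "int n dvd b - a" by (simp add: mod_eq_dvd_iff)
  with ab show False by (auto dest: zdvd_imp_le)
qed

lemma nbhd_vx:
  assumes "0 < n"
  shows "nbhd (cycle_graph n) (vx n z) = {vx n (z + 1), vx n (z - 1)}"
proof -
  have succ: "(vx n a + 1) mod n = vx n (a + 1)" for a
  proof -
    have "int ((vx n a + 1) mod n) = (a mod int n + 1) mod int n"
      using assms by (simp add: zmod_int int_vx add.commute)
    also have "\<dots> = int (vx n (a + 1))"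
      using assms by (simp add: int_vx mod_add_left_eq)
    finally show ?thesis by (simp only: of_nat_eq_iff)
  qed
  show ?thesis
  proof (intro equalityI subsetI)
    fix w assume "w \<in> nbhd (cycle_graph n) (vx n z)"
    then obtain i where i: "i < n" "{vx n z, w} = {i, (i + 1) mod n}"
      by (auto simp: nbhd_def cycle_graph_def)
    have iv: "(i + 1) mod n = vx n (int i + 1)"
      using succ[of "int i"] vx_of_nat[OF i(1)] by simp
    consider "vx n z = i" "w = vx n (int i + 1)" | "vx n z = vx n (int i + 1)" "w = i"
      using i(2) iv by (auto simp: doubleton_eq_iff)
    then show "w \<in> {vx n (z + 1), vx n (z - 1)}"
    proof cases
      case 1
      then have "vx n (z + 1) = vx n (int i + 1)"
        using vx_add_cong[of n z "int i" 1] vx_of_nat[OF i(1)] assms by simp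
      with 1 show ?thesis by simp
    next
      case 2
      then have "vx n (z - 1) = vx n (int i)"
        using vx_add_cong[of n z "int i + 1" "-1"] assms by simp
      with 2 show ?thesis using vx_of_nat[OF i(1)] by simp
    qed
  next
    fix w assume "w \<in> {vx n (z + 1), vx n (z - 1)}"
    then show "w \<in> nbhd (cycle_graph n) (vx n z)"
    proof (elim insertE emptyE)
      assume "w = vx n (z + 1)"
      then show ?thesis using succ[of z] vx_less[OF assms]
        by (auto simp: nbhd_def cycle_graph_def intro!: image_eqI[of _ _ "vx n z"])
    next
      assume "w = vx n (z - 1)"
      then show ?thesis using succ[of "z - 1"] vx_less[OF assms]
        by (auto simp: nbhd_def cycle_graph_def insert_commute intro!: image_eqI[of _ _ "vx n (z - 1)"])
    qed
  qed
qed

lemma moves_vx: "0 < n \<Longrightarrow> moves (cycle_graph n) (vx n z) = {vx n z, vx n (z + 1), vx n (z - 1)}"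
  by (simp add: moves_def nbhd_vx)

lemma moves_vxE:
  assumes "w \<in> moves (cycle_graph n) (vx n z)" "0 < n"
  obtains e where "w = vx n (z + e)" "\<bar>e\<bar> \<le> 1"
proof -
  from assms have "w = vx n (z + 0) \<or> w = vx n (z + 1) \<or> w = vx n (z + (- 1))"
    by (auto simp: moves_vx)
  with that show ?thesis by (metis abs_0 abs_1 abs_minus_cancel order_refl zero_le_one)
qed

lemma vx_in_moves: "0 < n \<Longrightarrow> \<bar>a - b\<bar> \<le> 1 \<Longrightarrow> vx n a \<in> moves (cycle_graph n) (vx n b)"
proof -
  assume "0 < n" and "\<bar>a - b\<bar> \<le> 1"
  then have "a = b \<or> a = b + 1 \<or> a = b - 1" by linarith
  with \<open>0 < n\<close> show ?thesis by (auto simp: moves_vx)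
qed

lemma moves_cycle_less: "u < n \<Longrightarrow> w \<in> moves (cycle_graph n) u \<Longrightarrow> w < n"
  using moves_vx[of n "int u"] vx_less[of n] by (auto simp: vx_of_nat)

lemma moves_cycle_interior:
  assumes "0 < y" "y < n - 1" "w \<in> moves (cycle_graph n) y"
  shows "w = y \<or> w = y + 1 \<or> w = y - 1"
proof -
  have "int y + 1 = int (y + 1)" "int y - 1 = int (y - 1)" "y + 1 < n" "y - 1 < n"
    using assms by auto
  then have "vx n (int y + 1) = y + 1" "vx n (int y - 1) = y - 1"
    by (simp_all only: vx_of_nat)
  then show ?thesis using assms moves_vx[of n "int y"] by (auto simp: vx_of_nat)
qed

lemma not_in_moves_vx:
  assumes "c + 2 \<le> z" "z \<le> c + int n - 2"
  shows "vx n z \<notin> moves (cycle_graph n) (vx n c)"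
proof -
  have "0 < n" using assms by linarith
  then show ?thesis
    using assms vx_neq[of c z n] vx_neq[of "c + 1" z n] vx_neq[of "c - 1" z n]
    by (auto simp: moves_vx)
qed

lemma moves_refl: "u \<in> moves G u"
  by (simp add: moves_def)

lemma lift_exists:
  assumes "u < n" obtains z where "u = vx n z" "c \<le> z" "z < c + int n"
proof
  show "u = vx n (c + (int u - c) mod int n)"
    using assms by (simp add: vx_def mod_add_right_eq)
qed (use assms in auto)

section \<open>Sweeping the cycle with two cops\<close>

text \<open>Standing still in all other configurations makes the move legal after every history, as
  \<open>cop_strategies\<close> demands.\<close>

definition sweep_move :: "nat \<Rightarrow> nat list \<Rightarrow> nat list" where
  "sweep_move n xs =
     (if \<exists>a b. xs = [a, b] \<and> a < b \<and> b < n then [xs ! 0 + 1, xs ! 1 - 1] else xs)"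

lemma sweep_move_pair [simp]: "a < b \<Longrightarrow> b < n \<Longrightarrow> sweep_move n [a, b] = [a + 1, b - 1]"
  by (simp add: sweep_move_def)

lemma sweep_move_in_cop_moves: "sweep_move n xs \<in> cop_moves (cycle_graph n) xs"
proof (cases "\<exists>a b. xs = [a, b] \<and> a < b \<and> b < n")
  case True
  then obtain a b where ab: "xs = [a, b]" "a < b" "b < n" by blast
  have "a + 1 \<in> moves (cycle_graph n) a" "b - 1 \<in> moves (cycle_graph n) b"
    using ab vx_in_moves[of n "int (a + 1)" "int a"] vx_in_moves[of n "int (b - 1)" "int b"]
      vx_of_nat[of "a + 1" n] vx_of_nat[of "b - 1" n] vx_of_nat[of a n] vx_of_nat[of b n]
    by simp_all
  with ab show ?thesis by (simp add: cop_moves_def)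
next
  case False
  then have "sweep_move n xs = xs" by (simp only: sweep_move_def if_False)
  then show ?thesis by (simp add: cop_moves_def list_all2_refl moves_refl)
qed

text \<open>A robber within one step of a cop is caught at once. Otherwise his next vertex still
  lies between the advanced cops, and the interval has shrunk by two.\<close>

lemma cops_win_sweep:
  assumes "a \<le> y" "y \<le> b" "b < n"
  shows "cops_win (cycle_graph n) [a, b] y"
  using assms
proof (induction "b - a" arbitrary: a b y rule: less_induct)
  case less
  show ?case
  proof (cases "y \<in> {a, b, a + 1, b - 1}")
    case True
    then have "y \<in> set [a, b] \<or> a < b \<and> y \<in> set (sweep_move n [a, b])"
      using less.prems by (cases "a < b") auto
    then show ?thesis
      using cops_win.caught[of y "[a, b]" "cycle_graph n"]
        cops_win.catch[OF sweep_move_in_cop_moves, of y n "[a, b]"] by blast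
  next
    case False
    with less.prems have y: "a + 1 < y" "y < b - 1" by auto
    have move: "[a + 1, b - 1] \<in> cop_moves (cycle_graph n) [a, b]"
      using sweep_move_in_cop_moves[of n "[a, b]"] y less.prems by simp
    show ?thesis
    proof (rule cops_win.step[OF move])
      fix y' assume "y' \<in> moves (cycle_graph n) y"
      then have "y' = y \<or> y' = y + 1 \<or> y' = y - 1"
        using y less.prems by (intro moves_cycle_interior[of y n]) auto
      then show "cops_win (cycle_graph n) [a + 1, b - 1] y'"
        using y less.prems by (intro less.hyps) auto
    qed
  qed
qed

section \<open>One cop is not enough: the cop number of the cycle\<close>

lemma cops_win_Nil: "cops_win G xs y \<Longrightarrow> xs \<noteq> []"
  by (induction rule: cops_win.induct) (auto simp: cop_moves_def intro: moves_refl)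

text \<open>The vertices outside the closed neighbourhood of the cop form a nonempty path, and a
  robber next to the cop is adjacent to an end of it.\<close>

lemma evade_single_cop:
  assumes "4 \<le> n" "u < n" "y < n" "y \<noteq> u"
  shows "\<exists>y'\<in>moves (cycle_graph n) y. y' \<notin> moves (cycle_graph n) u"
proof -
  obtain z where z: "y = vx n z" "int u \<le> z" "z < int u + int n"
    using lift_exists[OF assms(3)] .
  have u: "u = vx n (int u)" using assms by (simp add: vx_of_nat)
  have "z \<noteq> int u" using z u assms by auto
  then obtain z' where "\<bar>z' - z\<bar> \<le> 1" "int u + 2 \<le> z'" "z' \<le> int u + int n - 2"
    using z(2,3) assms(1)
      that[of "if z = int u + 1 then z + 1 else if z = int u + int n - 1 then z - 1 else z"]
    by (auto split: if_splits)
  then show ?thesis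
    using z(1) assms(1) u vx_in_moves[of n z' z] not_in_moves_vx[of "int u" z' n] by auto
qed

text \<open>Rule induction: a winning move of the cop must be good against every reply, but
  \<open>evade_single_cop\<close> supplies a reply out of his reach.\<close>

lemma cops_win_single:
  "cops_win (cycle_graph n) xs y \<Longrightarrow> 4 \<le> n \<Longrightarrow> xs = [u] \<Longrightarrow> u < n \<Longrightarrow> y < n
    \<Longrightarrow> y \<in> moves (cycle_graph n) u"
proof (induction arbitrary: u rule: cops_win.induct)
  case (caught y xs)
  then show ?case by (simp add: moves_refl)
next
  case (catch xs' xs y)
  then show ?case by (auto simp: cop_moves_def list_all2_Cons1)
next
  case (step xs' xs y)
  then obtain u' where u': "xs' = [u']" "u' \<in> moves (cycle_graph n) u"
    by (auto simp: cop_moves_def list_all2_Cons1)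
  have "u' < n" using u' step.prems moves_cycle_less by blast
  show ?case
  proof (rule ccontr)
    assume "y \<notin> moves (cycle_graph n) u"
    then have "y \<noteq> u'" using u' by auto
    then obtain y' where y': "y' \<in> moves (cycle_graph n) y" "y' \<notin> moves (cycle_graph n) u'"
      using evade_single_cop step.prems \<open>u' < n\<close> by blast
    show False
      using step.IH[OF y'(1) step.prems(1) u'(1) \<open>u' < n\<close>] y' step.prems moves_cycle_less by blast
  qed
qed

lemma cop_number_cycle:
  assumes "4 \<le> n"
  shows "cop_number (cycle_graph n) = 2"
  unfolding cop_number_def
proof (rule Least_equality)
  show "\<exists>xs\<in>placements (cycle_graph n) 2. \<forall>y\<in>verts (cycle_graph n). cops_win (cycle_graph n) xs y"
  proof (intro bexI[of _ "[0, n - 1]"] ballI)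
    show "cops_win (cycle_graph n) [0, n - 1] y" if "y \<in> verts (cycle_graph n)" for y
      using that assms by (intro cops_win_sweep) (auto simp: cycle_graph_def)
  qed (use assms in \<open>auto simp: placements_def cycle_graph_def\<close>)
next
  fix k assume "\<exists>xs\<in>placements (cycle_graph n) k. \<forall>y\<in>verts (cycle_graph n). cops_win (cycle_graph n) xs y"
  then obtain xs where xs: "length xs = k" "set xs \<subseteq> {..<n}"
      "\<And>y. y < n \<Longrightarrow> cops_win (cycle_graph n) xs y"
    by (auto simp: placements_def cycle_graph_def)
  show "2 \<le> k"
  proof (rule ccontr)
    assume "\<not> 2 \<le> k"
    then have "length xs = 0 \<or> length xs = 1" using xs(1) by linarith
    then consider "xs = []" | u where "xs = [u]" "u < n"
      using xs(2) by (auto simp: length_Suc_conv)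
    then show False
    proof cases
      case 1
      then show ?thesis using cops_win_Nil[OF xs(3)[of 0]] assms by simp
    next
      case 2
      have "vx n (int u + 2) \<notin> moves (cycle_graph n) (vx n (int u))"
        using assms by (intro not_in_moves_vx) auto
      then show ?thesis
        using cops_win_single[OF xs(3)[of "vx n (int u + 2)"] assms 2] vx_less assms 2
        by (auto simp: vx_of_nat)
    qed
  qed
qed

section \<open>The sweep against an invisible robber\<close>

definition sweep :: "nat \<Rightarrow> nat cop_strategy" where
  "sweep n X = return_pmf (sweep_move n (last X))"

lemma sweep_in_cop_strategies: "sweep n \<in> cop_strategies (cycle_graph n)"
  by (simp add: cop_strategies_def sweep_def sweep_move_in_cop_moves)

lemma prefix_pmf_SucE:
  assumes "h \<in> set_pmf (prefix_pmf \<sigma> \<rho> \<mu> (Suc (Suc t)))"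
  obtains h' x y where "h = h' @ [(x, y)]" "h' \<in> set_pmf (prefix_pmf \<sigma> \<rho> \<mu> (Suc t))" "h' \<noteq> []"
    "x \<in> set_pmf (\<sigma> (map fst h'))" "y \<in> set_pmf (\<rho> (map fst h' @ [x]) (map snd h'))"
proof -
  from assms obtain h' z where h': "h' \<in> set_pmf (prefix_pmf \<sigma> \<rho> \<mu> (Suc t))" "h = h' @ [z]"
      "z \<in> set_pmf (round_pmf \<sigma> \<rho> \<mu> h')"
    unfolding prefix_pmf.simps(2)[of _ _ _ "Suc t"] set_bind_pmf set_map_pmf by blast
  have "h' \<noteq> []" using length_prefix_pmf[OF h'(1)] by auto
  with h' that show ?thesis by (auto simp: round_pmf_def)
qed

text \<open>The robber stays strictly between the cops and so never reaches the edge between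
  \<open>n - 1\<close> and \<open>0\<close>. His moves are constrained only at vertices of the
  cycle, so that the lemma also covers \<open>drunk\<close>, whose law is unspecified at numbers
  without neighbours.\<close>

lemma sweep_uncaught:
  assumes "h \<in> set_pmf (prefix_pmf (sweep n) \<rho> \<mu> (Suc t))" "uncaught h"
    and \<mu>: "\<And>z. z \<in> set_pmf \<mu> \<Longrightarrow> fst z = [0, n - 1] \<and> snd z < n"
    and \<rho>: "\<And>X Y. Y \<noteq> [] \<Longrightarrow> last Y < n \<Longrightarrow> set_pmf (\<rho> X Y) \<subseteq> moves (cycle_graph n) (last Y)"
  shows "fst (last h) = [t, n - 1 - t] \<and> t < snd (last h) \<and> snd (last h) < n - 1 - t"
  using assms(1,2)
proof (induction t arbitrary: h)
  case 0
  then obtain x y where h: "h = [(x, y)]" "(x, y) \<in> set_pmf \<mu>"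
    by (auto simp: round_pmf_def)
  with \<mu>[OF h(2)] 0 show ?case by auto
next
  case (Suc t)
  from Suc.prems(1) obtain h' x y where h: "h = h' @ [(x, y)]"
    "h' \<in> set_pmf (prefix_pmf (sweep n) \<rho> \<mu> (Suc t))" "h' \<noteq> []"
    "x \<in> set_pmf (sweep n (map fst h'))" "y \<in> set_pmf (\<rho> (map fst h' @ [x]) (map snd h'))"
    by (rule prefix_pmf_SucE)
  let ?z = "snd (last h')"
  have un: "uncaught h'" "y \<notin> set x" "?z \<notin> set x"
    using Suc.prems(2) h by (auto simp: uncaught_snoc)
  have IH: "fst (last h') = [t, n - 1 - t]" "t < ?z" "?z < n - 1 - t"
    using Suc.IH[OF h(2) un(1)] by auto
  have x: "x = [t + 1, n - 1 - t - 1]"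
    using h(3,4) IH by (simp add: sweep_def last_map)
  have "y \<in> moves (cycle_graph n) ?z"
  proof -
    have "?z < n" using IH by linarith
    then show ?thesis
      using h(3,5) \<rho>[of "map snd h'" "map fst h' @ [x]"] by (auto simp: last_map)
  qed
  then have "y = ?z \<or> y = ?z + 1 \<or> y = ?z - 1"
    using IH by (intro moves_cycle_interior[of ?z n]) auto
  then show ?case using un x IH h(1) by auto
qed

lemma suminf_ennreal_le_finite:
  fixes f :: "nat \<Rightarrow> real"
  assumes "\<And>t. t < m \<Longrightarrow> f t \<le> g t" "\<And>t. m \<le> t \<Longrightarrow> f t \<le> 0" "\<And>t. 0 \<le> f t"
  shows "(\<Sum>t. ennreal (f t)) \<le> ennreal (\<Sum>t<m. g t)"
proof -
  have "(\<Sum>t. ennreal (f t)) = (\<Sum>t<m. ennreal (f t))"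
    using assms(2) by (intro suminf_finite) (auto simp: ennreal_neg)
  also have "\<dots> = ennreal (\<Sum>t<m. f t)"
    using assms(3) by (intro sum_ennreal) auto
  also have "\<dots> \<le> ennreal (\<Sum>t<m. g t)"
    using assms(1) by (intro ennreal_leI sum_mono) auto
  finally show ?thesis .
qed

lemma ict_cycle_le:
  assumes "4 \<le> n"
  shows "ict (cycle_graph n) \<le> ennreal (real n / 2)"
proof -
  let ?G = "cycle_graph n" and ?x = "[0, n - 1]"
  have "ict_cops ?G 2 \<le> ict_from ?G ?x"
    unfolding ict_cops_def using assms by (intro INF_lower) (auto simp: placements_def cycle_graph_def)
  also have "\<dots> \<le> (SUP y\<in>verts ?G. ict_against ?G (sweep n) ?x y)"
    unfolding ict_from_def by (intro INF_lower sweep_in_cop_strategies)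
  also have "\<dots> \<le> ennreal (real n / 2)"
    unfolding ict_against_def
  proof (intro SUP_least)
    fix y \<rho> assume y: "y \<in> verts ?G" and \<rho>: "\<rho> \<in> robber_strategies ?G"
    let ?pr = "\<lambda>t. measure_pmf.prob (prefix_pmf (sweep n) \<rho> (return_pmf (?x, y)) (Suc t)) {h. uncaught h}"
    \<comment> \<open>From round \<open>n div 2\<close> on no vertex lies strictly between
      \<open>t\<close> and \<open>n - 1 - t\<close>.\<close>
    have "?pr t \<le> 0" if "n div 2 \<le> t" for t
    proof -
      have "\<not> uncaught h" if "h \<in> set_pmf (prefix_pmf (sweep n) \<rho> (return_pmf (?x, y)) (Suc t))" for h
        using sweep_uncaught[OF that] y \<rho> \<open>n div 2 \<le> t\<close>
        by (fastforce simp: robber_strategies_def cycle_graph_def)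
      then have "?pr t = 0" by (subst measure_pmf_zero_iff) auto
      then show ?thesis by simp
    qed
    then have "expected_capture_time (sweep n) \<rho> (return_pmf (?x, y)) \<le> ennreal (\<Sum>t<n div 2. 1)"
      unfolding expected_capture_time_eq_suminf by (intro suminf_ennreal_le_finite) auto
    also have "\<dots> \<le> ennreal (real n / 2)"
      by (intro ennreal_leI) simp
    finally show "expected_capture_time (sweep n) \<rho> (return_pmf (?x, y)) \<le> ennreal (real n / 2)" .
  qed
  finally show ?thesis by (simp add: ict_def cop_number_cycle assms)
qed

section \<open>The drunk robber\<close>

definition coin :: "int pmf" where
  "coin = pmf_of_set {1, -1}"

lemma set_pmf_coin [simp]: "set_pmf coin = {1, -1}"
  by (simp add: coin_def)

text \<open>With at least three vertices the two neighbours differ, so a uniform neighbour is a fair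
  sign added on the line.\<close>

lemma drunk_cycle:
  assumes "3 \<le> n" "last Y < n"
  shows "drunk (cycle_graph n) X Y = map_pmf (\<lambda>e. vx n (int (last Y) + e)) coin"
proof -
  let ?y = "int (last Y)"
  have "vx n (?y - 1) \<noteq> vx n (?y + 1)" using assms by (intro vx_neq) auto
  then have "map_pmf (\<lambda>e. vx n (?y + e)) (pmf_of_set {1, -1}) = pmf_of_set ((\<lambda>e. vx n (?y + e)) ` {1, -1})"
    by (intro map_pmf_of_set_inj) (auto simp: inj_on_def)
  moreover have "nbhd (cycle_graph n) (last Y) = (\<lambda>e. vx n (?y + e)) ` {1, -1}"
    using nbhd_vx[of n ?y] assms by (simp add: vx_of_nat)
  ultimately show ?thesis by (simp add: drunk_def coin_def)
qed

lemma map_pmf_rotate_uniform: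
  assumes "0 < n"
  shows "map_pmf (\<lambda>y. vx n (int y + e)) (pmf_of_set {..<n}) = pmf_of_set {..<n}"
proof (rule map_pmf_of_set_bij_betw)
  have inj: "inj_on (\<lambda>y. vx n (int y + e)) {..<n}"
  proof (rule inj_onI)
    fix x y assume "x \<in> {..<n}" "y \<in> {..<n}" "vx n (int x + e) = vx n (int y + e)"
    then show "x = y"
      using vx_add_cong[of n "int x + e" "int y + e" "- e"] assms by (simp add: vx_of_nat)
  qed
  moreover have "(\<lambda>y. vx n (int y + e)) ` {..<n} = {..<n}"
    using endo_inj_surj[OF _ _ inj] vx_less[OF assms] by auto
  ultimately show "bij_betw (\<lambda>y. vx n (int y + e)) {..<n} {..<n}"
    by (simp add: bij_betw_def)
qed (use assms in auto)

text \<open>The uniform law is stationary: after exchanging the draws of coin and position, each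
  coin value rotates a uniform vertex. The cops do not enter, since \<open>drunk\<close> ignores
  them.\<close>

lemma drunk_marginal_uniform:
  assumes "3 \<le> n" and \<mu>: "map_pmf snd \<mu> = pmf_of_set {..<n}"
  shows "map_pmf (\<lambda>h. snd (last h)) (prefix_pmf \<sigma> (drunk (cycle_graph n)) \<mu> (Suc t)) = pmf_of_set {..<n}"
proof (induction t)
  case 0
  show ?case using \<mu> by (simp add: map_bind_pmf bind_return_pmf round_pmf_def pmf.map_comp comp_def)
next
  case (Suc t)
  let ?P = "prefix_pmf \<sigma> (drunk (cycle_graph n)) \<mu> (Suc t)"
  have lt: "snd (last h) < n" if "h \<in> set_pmf ?P" for h
  proof -
    have "snd (last h) \<in> set_pmf (map_pmf (\<lambda>h. snd (last h)) ?P)" using that by auto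
    then show ?thesis using assms(1) unfolding Suc.IH by (simp add: set_pmf_of_set lessThan_empty_iff)
  qed
  have "map_pmf (\<lambda>h. snd (last h)) (prefix_pmf \<sigma> (drunk (cycle_graph n)) \<mu> (Suc (Suc t)))
      = bind_pmf ?P (\<lambda>h. map_pmf snd (round_pmf \<sigma> (drunk (cycle_graph n)) \<mu> h))"
    unfolding prefix_pmf.simps(2)[of _ _ _ "Suc t"]
    by (simp only: map_bind_pmf pmf.map_comp comp_def last_snoc)
  also have "\<dots> = bind_pmf ?P (\<lambda>h. map_pmf (\<lambda>e. vx n (int (snd (last h)) + e)) coin)"
  proof (rule bind_pmf_cong[OF refl])
    fix h assume h: "h \<in> set_pmf ?P"
    then have "h \<noteq> []" using length_prefix_pmf[OF h] by auto
    then show "map_pmf snd (round_pmf \<sigma> (drunk (cycle_graph n)) \<mu> h) = map_pmf (\<lambda>e. vx n (int (snd (last h)) + e)) coin"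
      using lt[OF h] drunk_cycle[OF assms(1), of "map snd h"]
      by (simp add: round_pmf_def map_bind_pmf pmf.map_comp comp_def last_map)
  qed
  also have "\<dots> = bind_pmf (map_pmf (\<lambda>h. snd (last h)) ?P) (\<lambda>y. map_pmf (\<lambda>e. vx n (int y + e)) coin)"
    by (simp only: bind_map_pmf)
  also have "\<dots> = bind_pmf coin (\<lambda>e. map_pmf (\<lambda>y. vx n (int y + e)) (pmf_of_set {..<n}))"
    unfolding Suc.IH unfolding map_pmf_def by (rule bind_commute_pmf)
  also have "\<dots> = pmf_of_set {..<n}"
    using assms by (simp add: map_pmf_rotate_uniform)
  finally show ?case .
qed

lemma sum_sweep_le:
  assumes "4 \<le> n"
  shows "(\<Sum>t<n div 2. real (n - 2 - 2 * t) / real n) \<le> (real n - 1) / 4"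
proof -
  have gen: "(\<Sum>t<m. (c - 2 * real t)) = real m * (c + 1 - real m)" for m c
    by (induction m) (simp_all add: algebra_simps)
  have "(\<Sum>t<n div 2. real (n - 2 - 2 * t)) = (\<Sum>t<n div 2. (real n - 2) - 2 * real t)"
    using assms by (intro sum.cong) (auto simp: of_nat_diff)
  also have "\<dots> = real (n div 2) * (real n - 1 - real (n div 2))"
    by (simp add: gen)
  \<comment> \<open>The product is \<open>n (n - 2) / 4\<close> for even \<open>n\<close> and
    \<open>(n - 1)^2 / 4\<close> for odd \<open>n\<close>.\<close>
  also have "\<dots> \<le> real n * (real n - 1) / 4"
  proof (cases "even n")
    case True
    then obtain m where "n = 2 * m" by (elim evenE)
    then show ?thesis using assms by (simp add: algebra_simps)
  next
    case False
    then obtain m where "n = 2 * m + 1" by (elim oddE)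
    then show ?thesis by (simp add: algebra_simps)
  qed
  finally show ?thesis using assms by (simp add: sum_divide_distrib[symmetric] field_simps)
qed

text \<open>Survival forces the current position into the interval between the cops, and this
  position is uniform without any conditioning on the past.\<close>

lemma idct_cycle_le:
  assumes "4 \<le> n"
  shows "idct (cycle_graph n) \<le> ennreal ((real n - 1) / 4)"
proof -
  let ?G = "cycle_graph n" and ?x = "[0, n - 1]"
  let ?\<mu> = "map_pmf (Pair ?x) (pmf_of_set (verts ?G))"
  have verts: "verts ?G = {..<n}" by (simp add: cycle_graph_def)
  have "idct_cops ?G 2 \<le> idct_from ?G ?x"
    unfolding idct_cops_def using assms by (intro INF_lower) (auto simp: placements_def cycle_graph_def)
  also have "\<dots> \<le> expected_capture_time (sweep n) (drunk ?G) ?\<mu>"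
    unfolding idct_from_def by (intro INF_lower sweep_in_cop_strategies)
  also have "\<dots> \<le> ennreal (\<Sum>t<n div 2. real (n - 2 - 2 * t) / real n)"
    unfolding expected_capture_time_eq_suminf
  proof (rule suminf_ennreal_le_finite)
    fix t
    let ?P = "prefix_pmf (sweep n) (drunk ?G) ?\<mu> (Suc t)"
    have "measure_pmf.prob ?P {h. uncaught h} \<le> measure_pmf.prob ?P {h. snd (last h) \<in> {t<..<n - 1 - t}}"
    proof (rule measure_pmf.finite_measure_mono_AE)
      have "uncaught h \<longrightarrow> t < snd (last h) \<and> snd (last h) < n - 1 - t" if "h \<in> set_pmf ?P" for h
      proof
        assume "uncaught h"
        then show "t < snd (last h) \<and> snd (last h) < n - 1 - t"
        proof (rule conjunct2[OF sweep_uncaught[OF that]])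
          show "set_pmf (drunk ?G X Y) \<subseteq> moves ?G (last Y)" if "Y \<noteq> []" "last Y < n" for X Y
            using drunk_cycle[of n Y X] that assms moves_vx[of n "int (last Y)"]
            by (auto simp: vx_of_nat)
          show "fst z = ?x \<and> snd z < n" if "z \<in> set_pmf ?\<mu>" for z
            using that assms by (auto simp: verts set_pmf_of_set lessThan_empty_iff)
        qed
      qed
      then show "AE h in ?P. h \<in> {h. uncaught h} \<longrightarrow> h \<in> {h. snd (last h) \<in> {t<..<n - 1 - t}}"
        by (auto simp: AE_measure_pmf_iff)
    qed auto
    also have "\<dots> = measure_pmf.prob (map_pmf (\<lambda>h. snd (last h)) ?P) {t<..<n - 1 - t}"
      by (simp add: vimage_def)
    also have "\<dots> = real (card ({..<n} \<inter> {t<..<n - 1 - t})) / real n"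
      using assms
      by (subst drunk_marginal_uniform) (auto simp: verts pmf.map_comp comp_def measure_pmf_of_set lessThan_empty_iff)
    also have "{..<n} \<inter> {t<..<n - 1 - t} = {t<..<n - 1 - t}" by auto
    also have "card {t<..<n - 1 - t} = n - 2 - 2 * t" by simp
    finally have le: "measure_pmf.prob ?P {h. uncaught h} \<le> real (n - 2 - 2 * t) / real n" .
    then show "measure_pmf.prob ?P {h. uncaught h} \<le> real (n - 2 - 2 * t) / real n" .
    show "measure_pmf.prob ?P {h. uncaught h} \<le> 0" if "n div 2 \<le> t"
    proof -
      have "n - 2 - 2 * t = 0" using that by simp
      with le show ?thesis by simp
    qed
  qed simp
  also have "\<dots> \<le> ennreal ((real n - 1) / 4)"
    by (intro ennreal_leI sum_sweep_le assms)
  finally show ?thesis by (simp add: idct_def cop_number_cycle assms)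
qed

section \<open>The range of a random walk relative to a moving point\<close>

text \<open>Functions that vanish from \<open>t\<close> on: adding a sign is a function update,
  which leaves earlier partial sums unchanged.\<close>

primrec signs :: "nat \<Rightarrow> (nat \<Rightarrow> int) pmf" where
  "signs 0 = return_pmf (\<lambda>_. 0)"
| "signs (Suc t) = bind_pmf (signs t) (\<lambda>e. map_pmf (\<lambda>b. e(t := b)) coin)"

lemma finite_set_pmf_signs [simp]: "finite (set_pmf (signs t))"
  by (induction t) auto

lemma signs_range: "e \<in> set_pmf (signs t) \<Longrightarrow> k < t \<Longrightarrow> e k = 1 \<or> e k = -1"
proof (induction t arbitrary: e)
  case (Suc t)
  then obtain e' b where "e = e'(t := b)" "e' \<in> set_pmf (signs t)" "b = 1 \<or> b = -1"
    by auto
  with Suc.IH[of e'] Suc.prems(2) show ?case by (cases "k = t") auto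
qed simp

lemma integrable_signs [simp]: "integrable (measure_pmf (signs t)) (f :: _ \<Rightarrow> real)"
  by (rule integrable_measure_pmf_finite) simp

text \<open>Averaging over the last sign is the conditional expectation given the earlier ones; the
  martingale arguments below are inductions with this rule.\<close>

lemma expectation_signs_Suc:
  fixes f :: "(nat \<Rightarrow> int) \<Rightarrow> real"
  shows "measure_pmf.expectation (signs (Suc t)) f
    = measure_pmf.expectation (signs t) (\<lambda>e. (f (e(t := 1)) + f (e(t := -1))) / 2)"
proof -
  have step: "measure_pmf.expectation (map_pmf (\<lambda>b. e(t := b)) coin) f = (f (e(t := 1)) + f (e(t := -1))) / 2" for e
    by (simp add: coin_def integral_pmf_of_set)
  have "measure_pmf.expectation (signs (Suc t)) f = (\<Sum>e\<in>set_pmf (signs t).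
      pmf (signs t) e *\<^sub>R measure_pmf.expectation (map_pmf (\<lambda>b. e(t := b)) coin) f)"
    unfolding signs.simps by (rule pmf_expectation_bind) auto
  then show ?thesis
    unfolding step by (subst (2) integral_measure_pmf[of "set_pmf (signs t)"]) simp_all
qed

declare signs.simps(2) [simp del]

lemma expectation_signs_mono:
  fixes f :: "(nat \<Rightarrow> int) \<Rightarrow> real"
  assumes "\<And>e. e \<in> set_pmf (signs t) \<Longrightarrow> f e \<le> g e"
  shows "measure_pmf.expectation (signs t) f \<le> measure_pmf.expectation (signs t) g"
  by (rule integral_mono_AE) (auto simp: AE_measure_pmf_iff assms)

text \<open>The set \<open>K\<close> selects the rounds whose signs count, so that the rounds in
  which a cop moves up can be treated apart from the others.\<close>

definition psum :: "nat set \<Rightarrow> (nat \<Rightarrow> int) \<Rightarrow> nat \<Rightarrow> real" where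
  "psum K e s = (\<Sum>k<s. if k \<in> K then of_int (e k) else 0)"

primrec maxabs :: "nat set \<Rightarrow> (nat \<Rightarrow> int) \<Rightarrow> nat \<Rightarrow> real" where
  "maxabs K e 0 = 0"
| "maxabs K e (Suc s) = max (maxabs K e s) \<bar>psum K e (Suc s)\<bar>"

lemma psum_0 [simp]: "psum K e 0 = 0"
  by (simp add: psum_def)

lemma psum_Suc: "psum K e (Suc s) = psum K e s + (if s \<in> K then of_int (e s) else 0)"
  by (simp add: psum_def)

lemma psum_upd [simp]: "s \<le> t \<Longrightarrow> psum K (e(t := b)) s = psum K e s"
  unfolding psum_def by (intro sum.cong) auto

lemma maxabs_upd [simp]: "s \<le> t \<Longrightarrow> maxabs K (e(t := b)) s = maxabs K e s"
  by (induction s) auto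

lemma abs_psum_le_maxabs: "s \<le> t \<Longrightarrow> \<bar>psum K e s\<bar> \<le> maxabs K e t"
proof (induction t)
  case (Suc t)
  then show ?case by (cases "s = Suc t") auto
qed simp

abbreviation count_below :: "nat set \<Rightarrow> nat \<Rightarrow> nat" where
  "count_below K t \<equiv> card (K \<inter> {..<t})"

lemma count_below_Suc: "count_below K (Suc t) = count_below K t + (if t \<in> K then 1 else 0)"
proof (cases "t \<in> K")
  case True
  then have "K \<inter> {..<Suc t} = insert t (K \<inter> {..<t})" by auto
  with True show ?thesis by simp
next
  case False
  then have "K \<inter> {..<Suc t} = K \<inter> {..<t}" by (auto simp: less_Suc_eq)
  with False show ?thesis by simp
qed

lemma count_below_mono: "s \<le> t \<Longrightarrow> count_below K s \<le> count_below K t"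
  by (intro card_mono) auto

lemma expectation_psum: "measure_pmf.expectation (signs t) (\<lambda>e. psum K e t) = 0"
proof (induction t)
  case (Suc t)
  have "(psum K (e(t := 1)) (Suc t) + psum K (e(t := -1)) (Suc t)) / 2 = psum K e t" for e
    by (simp add: psum_Suc)
  then show ?case using Suc by (simp only: expectation_signs_Suc)
qed simp

lemma expectation_psum_power2:
  "measure_pmf.expectation (signs t) (\<lambda>e. (psum K e t)\<^sup>2) = real (count_below K t)"
proof (induction t)
  case (Suc t)
  have "((psum K (e(t := 1)) (Suc t))\<^sup>2 + (psum K (e(t := -1)) (Suc t))\<^sup>2) / 2
      = (psum K e t)\<^sup>2 + (if t \<in> K then 1 else 0)" for e
    by (simp add: psum_Suc power2_eq_square field_simps)
  then show ?case using Suc by (simp only: expectation_signs_Suc) (simp add: count_below_Suc)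
qed simp

text \<open>Doob's \<open>L\<^sup>2\<close> inequality: \<open>4 M \<bar>V\<bar> - 2 M\<^sup>2\<close> is a submartingale, where \<open>V\<close> is the partial
  sum and \<open>M\<close> its running maximum.\<close>

lemma expectation_maxabs_power2:
  "measure_pmf.expectation (signs t) (\<lambda>e. (maxabs K e t)\<^sup>2) \<le> 4 * real (count_below K t)"
proof -
  let ?H = "\<lambda>e t. 4 * maxabs K e t * \<bar>psum K e t\<bar> - 2 * (maxabs K e t)\<^sup>2"
  have "0 \<le> measure_pmf.expectation (signs t) (\<lambda>e. ?H e t)"
  proof (induction t)
    case (Suc t)
    have "?H e t \<le> (?H (e(t := 1)) (Suc t) + ?H (e(t := -1)) (Suc t)) / 2" for e
    proof -
      let ?M = "maxabs K e t" and ?V = "psum K e t"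
      have M: "0 \<le> ?M" using abs_psum_le_maxabs[of t t K e] by linarith
      \<comment> \<open>A new record \<open>v\<close> above the old maximum \<open>M\<close> raises
        the expression by \<open>2 (v - M)^2\<close>.\<close>
      have step: "4 * ?M * v - 2 * ?M\<^sup>2 \<le> 4 * max ?M v * v - 2 * (max ?M v)\<^sup>2" for v
        using zero_le_square[of "v - ?M"] by (auto simp: max_def power2_eq_square algebra_simps)
      define d :: real where "d = (if t \<in> K then 1 else 0)"
      have "2 * \<bar>?V\<bar> \<le> \<bar>?V + d\<bar> + \<bar>?V - d\<bar>" by linarith
      with M have "?M * (2 * \<bar>?V\<bar>) \<le> ?M * (\<bar>?V + d\<bar> + \<bar>?V - d\<bar>)" by (rule mult_left_mono[rotated])
      then have "8 * ?M * \<bar>?V\<bar> \<le> 4 * ?M * \<bar>?V + d\<bar> + 4 * ?M * \<bar>?V - d\<bar>"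
        by (simp add: algebra_simps)
      moreover have "psum K (e(t := 1)) (Suc t) = ?V + d" "psum K (e(t := -1)) (Suc t) = ?V - d"
        by (simp_all add: psum_Suc d_def)
      ultimately show ?thesis
        using step[of "\<bar>?V + d\<bar>"] step[of "\<bar>?V - d\<bar>"] by simp
    qed
    then have "measure_pmf.expectation (signs t) (\<lambda>e. ?H e t)
        \<le> measure_pmf.expectation (signs (Suc t)) (\<lambda>e. ?H e (Suc t))"
      unfolding expectation_signs_Suc by (intro expectation_signs_mono)
    with Suc show ?case by linarith
  qed simp
  \<comment> \<open>Completing the square: the two sides differ by \<open>(M - 2 |V|)^2\<close>.
    This is where the Doob factor 4 comes from.\<close>
  also have "\<dots> \<le> measure_pmf.expectation (signs t) (\<lambda>e. 4 * (psum K e t)\<^sup>2 - (maxabs K e t)\<^sup>2)"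
  proof (rule expectation_signs_mono)
    fix e
    show "?H e t \<le> 4 * (psum K e t)\<^sup>2 - (maxabs K e t)\<^sup>2"
      using zero_le_square[of "maxabs K e t - 2 * \<bar>psum K e t\<bar>"]
      by (simp add: power2_eq_square algebra_simps flip: abs_mult)
  qed
  also have "\<dots> = 4 * real (count_below K t) - measure_pmf.expectation (signs t) (\<lambda>e. (maxabs K e t)\<^sup>2)"
    by (simp add: expectation_psum_power2)
  finally show ?thesis by linarith
qed

text \<open>The inequality of the means with a free parameter: \<open>c\<close> trades an additive
  constant for a small multiple of the number of rounds, and that multiple is paid from the slack of
  the trajectory.\<close>

lemma expectation_twice_maxabs:
  assumes "0 < c"
  shows "measure_pmf.expectation (signs t) (\<lambda>e. 2 * maxabs K e t) \<le> c + 4 * real (count_below K t) / c"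
proof -
  have "measure_pmf.expectation (signs t) (\<lambda>e. 2 * maxabs K e t)
      \<le> measure_pmf.expectation (signs t) (\<lambda>e. c + (maxabs K e t)\<^sup>2 / c)"
  proof (rule expectation_signs_mono)
    fix e
    have "2 * maxabs K e t * c \<le> c * c + (maxabs K e t)\<^sup>2"
      using zero_le_square[of "maxabs K e t - c"] by (simp add: power2_eq_square algebra_simps)
    then show "2 * maxabs K e t \<le> c + (maxabs K e t)\<^sup>2 / c"
      using assms by (simp add: field_simps)
  qed
  also have "\<dots> \<le> c + 4 * real (count_below K t) / c"
    using expectation_maxabs_power2[where K=K and t=t] assms by (simp add: divide_right_mono)
  finally show ?thesis .
qed

text \<open>For \<open>c = -1\<close> this is the trajectory as seen from the walk. The sign is a
  parameter because reflecting the trajectory reverses it.\<close>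

definition rel_walk :: "(nat \<Rightarrow> int) \<Rightarrow> int \<Rightarrow> (nat \<Rightarrow> int) \<Rightarrow> nat \<Rightarrow> int" where
  "rel_walk x c e s = x s + c * (\<Sum>k<s. e k)"

lemma rel_walk_Suc: "rel_walk x c e (Suc s) = rel_walk x c e s + (x (Suc s) - x s) + c * e s"
  by (simp add: rel_walk_def algebra_simps)

text \<open>A bound on the range, maximum minus minimum. In the form of pairwise differences it can
  be proved by telescoping.\<close>

definition spread_le :: "(nat \<Rightarrow> int) \<Rightarrow> nat \<Rightarrow> real \<Rightarrow> bool" where
  "spread_le w t B \<longleftrightarrow> (\<forall>r\<le>t. \<forall>s\<le>t. real_of_int (w s - w r) \<le> B)"

lemma spread_leI:
  assumes "\<And>r s. r \<le> s \<Longrightarrow> s \<le> t \<Longrightarrow> real_of_int (w s - w r) \<le> B"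
    and "\<And>r s. r \<le> s \<Longrightarrow> s \<le> t \<Longrightarrow> real_of_int (w r - w s) \<le> B"
  shows "spread_le w t B"
  unfolding spread_le_def using assms by (metis nle_le)

text \<open>It follows from \<open>(v + p)^2 \<ge> 0\<close>. For \<open>v\<close> of variance
  \<open>p\<close> the right side has mean 1/2, so replacing \<open>p + v\<close> by its maximum
  with \<open>2 * u\<close> costs at most 1/2 in the mean.\<close>

lemma max_excess_le:
  fixes p u v :: real
  assumes "0 < p" "4 * u \<le> p"
  shows "max 0 (2 * u - (p + v)) \<le> v\<^sup>2 / (2 * p)"
proof (rule max.boundedI)
  have "- p / 2 - v \<le> v\<^sup>2 / (2 * p)"
    using assms zero_le_square[of "v + p"] by (simp add: field_simps power2_eq_square)
  then show "2 * u - (p + v) \<le> v\<^sup>2 / (2 * p)" using assms by simp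
qed (use assms in simp)

text \<open>If the point moves up in most rounds, the relative walk rarely goes down, and its range is
  essentially its final value, whose mean is at most \<open>t\<close>. The expected fluctuation caused by
  the \<open>u\<close> other rounds is of order \<open>\<surd>u\<close>; these rounds cost \<open>u\<close> in the mean.\<close>

lemma spread_mostly_up:
  fixes x :: "nat \<Rightarrow> int"
  assumes x: "\<And>k. k < t \<Longrightarrow> \<bar>x (Suc k) - x k\<bar> \<le> 1" and c: "c = 1 \<or> c = -1"
    and up: "4 * t \<le> 5 * count_below {k. x (Suc k) - x k = 1} t"
  shows "\<exists>B. (\<forall>e\<in>set_pmf (signs t). spread_le (rel_walk x c e) t (B e))
    \<and> measure_pmf.expectation (signs t) B \<le> real t + 20"
proof -
  let ?P = "{k. x (Suc k) - x k = 1}"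
  let ?K = "- ?P"
  define p where "p = real (count_below ?P t)"
  define u where "u = real (count_below ?K t)"
  have "count_below ?P s + count_below ?K s = s" for s
    by (induction s) (auto simp: count_below_Suc)
  then have pu: "p + u = real t" unfolding p_def u_def by (metis of_nat_add)
  have p4: "4 * u \<le> p" using up pu unfolding p_def by linarith
  \<comment> \<open>In an up round the relative walk gains \<open>1 + c * e k\<close>, which is 0 or
    2. So \<open>Y\<close> is nondecreasing along the rounds, and its final value has mean
    \<open>p\<close>.\<close>
  define Y where "Y e s = real (count_below ?P s) + of_int c * psum ?P e s" for e s
  \<comment> \<open>A rise is at most \<open>Y e t\<close> plus the fluctuation over the other
    rounds. A fall happens only in the \<open>u\<close> other rounds, by at most 2 in each. The
    first and last summands add up to the maximum of \<open>Y e t\<close> and \<open>2 * u\<close>,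
    which covers both.\<close>
  define B where "B e = Y e t + 2 * maxabs ?K e t + max 0 (2 * u - Y e t)" for e
  have "spread_le (rel_walk x c e) t (B e)" if e: "e \<in> set_pmf (signs t)" for e
  proof (rule spread_leI)
    fix r s assume rs: "r \<le> s" "s \<le> t"
    let ?w = "rel_walk x c e"
    have ce: "c * e k = 1 \<or> c * e k = -1" if "k < t" for k
      using signs_range[OF e that] c by auto
    have Y_Suc: "Y e (Suc k) = Y e k + (if k \<in> ?P then 1 + of_int (c * e k) else 0)" for k
      by (simp add: Y_def count_below_Suc psum_Suc algebra_simps)
    have Y_mono: "Y e i \<le> Y e j" if "i \<le> j" "j \<le> t" for i j
      using that
    proof (induction j rule: dec_induct)
      case (step j)
      have "0 \<le> 1 + c * e j" using ce[of j] step by auto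
      then have "(0::real) \<le> 1 + of_int (c * e j)" by linarith
      then show ?case using step by (simp add: Y_Suc del: of_int_mult)
    qed simp
    have Y0: "Y e 0 = 0" by (simp add: Y_def)
    have "real_of_int (?w s - ?w r) \<le> Y e s - Y e r + of_int c * (psum ?K e s - psum ?K e r)"
      using rs
    proof (induction s rule: dec_induct)
      case (step j)
      have "\<bar>x (Suc j) - x j\<bar> \<le> 1" using x step by simp
      then have d: "x (Suc j) - x j \<le> (if j \<in> ?P then 1 else 0)" by auto
      have "real_of_int (?w (Suc j) - ?w r) = real_of_int (?w j - ?w r) + of_int (x (Suc j) - x j) + of_int (c * e j)"
        by (simp add: rel_walk_Suc)
      also have "real_of_int (x (Suc j) - x j) \<le> (if j \<in> ?P then 1 else 0)"
        using d by (auto split: if_splits)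
      finally show ?case using step
        by (auto simp: Y_Suc psum_Suc algebra_simps split: if_splits)
    qed simp
    moreover have "of_int c * (psum ?K e s - psum ?K e r) \<le> 2 * maxabs ?K e t"
      using abs_psum_le_maxabs[of s t ?K e] abs_psum_le_maxabs[of r t ?K e] rs c by auto
    ultimately show "real_of_int (?w s - ?w r) \<le> B e"
      using Y_mono[of s t] Y_mono[of 0 r] Y0 rs unfolding B_def by linarith
    have "real_of_int (?w r - ?w s) \<le> 2 * (real (count_below ?K s) - real (count_below ?K r))"
      using rs
    proof (induction s rule: dec_induct)
      case (step j)
      have "\<bar>x (Suc j) - x j\<bar> \<le> 1" using x step by simp
      moreover have "c * e j = 1 \<or> c * e j = -1" using ce[of j] step by simp
      ultimately have "- (x (Suc j) - x j) - c * e j \<le> (if j \<in> ?K then 2 else 0)"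
        by auto
      then have "real_of_int (- (x (Suc j) - x j) - c * e j) \<le> real_of_int (if j \<in> ?K then 2 else 0)"
        by (simp only: of_int_le_iff)
      moreover have "real_of_int (?w r - ?w (Suc j)) = real_of_int (?w r - ?w j) + real_of_int (- (x (Suc j) - x j) - c * e j)"
        by (simp add: rel_walk_Suc)
      ultimately show ?case using step
        by (simp add: count_below_Suc split: if_splits)
    qed simp
    moreover have "real (count_below ?K s) \<le> u"
      unfolding u_def using count_below_mono[OF rs(2)] by simp
    moreover have "0 \<le> maxabs ?K e t" using abs_psum_le_maxabs[of t t ?K e] by linarith
    moreover have "a \<le> y + 2 * m + max 0 (2 * v - y)"
      if "a \<le> 2 * (i - real j)" "i \<le> v" "0 \<le> m" for a i m y v and j :: nat
      using that by (auto simp: max_def)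
    ultimately show "real_of_int (?w r - ?w s) \<le> B e"
      unfolding B_def by blast
  qed
  moreover have "measure_pmf.expectation (signs t) B \<le> real t + 20"
  proof (cases "p = 0")
    case True
    then have "t = 0" using pu p4 by auto
    then show ?thesis by (simp add: B_def Y_def u_def)
  next
    case False
    then have p: "0 < p" unfolding p_def by linarith
    have "measure_pmf.expectation (signs t) B
        \<le> measure_pmf.expectation (signs t) (\<lambda>e. (p + of_int c * psum ?P e t) + 2 * maxabs ?K e t + (psum ?P e t)\<^sup>2 / (2 * p))"
    proof (rule expectation_signs_mono)
      fix e
      let ?V = "of_int c * psum ?P e t"
      have V2: "?V\<^sup>2 = (psum ?P e t)\<^sup>2" using c by auto
      show "B e \<le> (p + ?V) + 2 * maxabs ?K e t + (psum ?P e t)\<^sup>2 / (2 * p)"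
        unfolding B_def Y_def p_def[symmetric]
        using max_excess_le[OF p p4, of ?V, unfolded V2] by (rule add_left_mono)
    qed
    also have "\<dots> = p + measure_pmf.expectation (signs t) (\<lambda>e. 2 * maxabs ?K e t) + 1 / 2"
      using p by (simp add: expectation_psum expectation_psum_power2 p_def[symmetric] del: integral_mult_right)
    \<comment> \<open>With parameter 8 the fluctuation costs \<open>8 + u / 2\<close>, and
      \<open>u / 2\<close> is available because \<open>p + u = t\<close>.\<close>
    also have "\<dots> \<le> p + (8 + 4 * u / 8) + 1 / 2"
      using expectation_twice_maxabs[of 8 t ?K] unfolding u_def by simp
    also have "\<dots> \<le> real t + 20" using pu by (simp add: u_def)
    finally show ?thesis .
  qed
  ultimately show ?thesis by blast
qed

lemma spread_le_uminus: "spread_le (\<lambda>s. - w s) t B \<longleftrightarrow> spread_le w t B"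
  by (auto simp: spread_le_def)

text \<open>The trajectory itself spans at most \<open>4 / 5 * t\<close>. The walk adds twice its
  maximum, whose mean with parameter 20 is at most \<open>20 + t / 5\<close>; this is the origin of
  the constant 20.\<close>

lemma spread_balanced:
  fixes x :: "nat \<Rightarrow> int"
  assumes x: "\<And>k. k < t \<Longrightarrow> \<bar>x (Suc k) - x k\<bar> \<le> 1" and c: "c = 1 \<or> c = -1"
    and up: "5 * count_below {k. x (Suc k) - x k = 1} t \<le> 4 * t"
    and down: "5 * count_below {k. x (Suc k) - x k = -1} t \<le> 4 * t"
  shows "\<exists>B. (\<forall>e\<in>set_pmf (signs t). spread_le (rel_walk x c e) t (B e))
    \<and> measure_pmf.expectation (signs t) B \<le> real t + 20"
proof (intro exI conjI ballI)
  let ?P = "{k. x (Suc k) - x k = 1}" and ?Q = "{k. x (Suc k) - x k = -1}"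
  fix e assume e: "e \<in> set_pmf (signs t)"
  have w: "real_of_int (rel_walk x c e s) = of_int (x s) + of_int c * psum UNIV e s" for s
    by (simp add: rel_walk_def psum_def)
  show "spread_le (rel_walk x c e) t (4 / 5 * real t + 2 * maxabs UNIV e t)"
  proof (rule spread_leI)
    fix r s assume rs: "r \<le> s" "s \<le> t"
    have diff: "\<bar>of_int c * psum UNIV e s - of_int c * psum UNIV e r\<bar> \<le> 2 * maxabs UNIV e t"
      using abs_psum_le_maxabs[of s t UNIV e] abs_psum_le_maxabs[of r t UNIV e] rs c by auto
    have "x s - x r \<le> int (count_below ?P s) - int (count_below ?P r)
        \<and> x r - x s \<le> int (count_below ?Q s) - int (count_below ?Q r)"
      using rs
    proof (induction s rule: dec_induct)
      case (step j)
      then show ?case using x[of j] by (auto simp: count_below_Suc)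
    qed simp
    moreover have "count_below ?P s \<le> count_below ?P t" "count_below ?Q s \<le> count_below ?Q t"
      using count_below_mono[OF rs(2)] by auto
    ultimately have "5 * (x s - x r) \<le> 4 * int t" "5 * (x r - x s) \<le> 4 * int t"
      using up[folded of_nat_le_iff[where 'a=int]] down[folded of_nat_le_iff[where 'a=int]]
      unfolding of_nat_mult by auto
    then have "5 * (real_of_int (x s) - real_of_int (x r)) \<le> 4 * real t"
        "5 * (real_of_int (x r) - real_of_int (x s)) \<le> 4 * real t"
      by (simp_all flip: of_int_le_iff[where 'a=real])
    moreover have "a + v - (b + w) \<le> 4 / 5 * real t + m"
      if "\<bar>v - w\<bar> \<le> m" "5 * (a - b) \<le> 4 * real t" for a b v w m :: real
    proof -
      have "v - w \<le> m" using that(1) by (rule order_trans[OF abs_ge_self])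
      then show ?thesis using that(2) by simp
    qed
    moreover have "b + w - (a + v) \<le> 4 / 5 * real t + m"
      if "\<bar>v - w\<bar> \<le> m" "5 * (b - a) \<le> 4 * real t" for a b v w m :: real
    proof -
      have "w - v \<le> m" using that(1) by (simp add: abs_le_iff)
      then show ?thesis using that(2) by simp
    qed
    ultimately show "real_of_int (rel_walk x c e s - rel_walk x c e r) \<le> 4 / 5 * real t + 2 * maxabs UNIV e t"
      "real_of_int (rel_walk x c e r - rel_walk x c e s) \<le> 4 / 5 * real t + 2 * maxabs UNIV e t"
      using diff unfolding of_int_diff w by blast+
  qed
next
  have "measure_pmf.expectation (signs t) (\<lambda>e. 4 / 5 * real t + 2 * maxabs UNIV e t)
      = 4 / 5 * real t + measure_pmf.expectation (signs t) (\<lambda>e. 2 * maxabs UNIV e t)"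
    by (simp del: integral_mult_right)
  also have "\<dots> \<le> real t + 20"
    using expectation_twice_maxabs[of 20 t UNIV] by simp
  finally show "measure_pmf.expectation (signs t) (\<lambda>e. 4 / 5 * real t + 2 * maxabs UNIV e t) \<le> real t + 20" .
qed

text \<open>A mostly descending trajectory becomes a mostly ascending one by reflection, which also
  turns \<open>c\<close> into \<open>- c\<close> and preserves the range.\<close>

lemma expected_spread:
  fixes x :: "nat \<Rightarrow> int"
  assumes x: "\<And>k. k < t \<Longrightarrow> \<bar>x (Suc k) - x k\<bar> \<le> 1" and c: "c = 1 \<or> c = -1"
  shows "\<exists>B. (\<forall>e\<in>set_pmf (signs t). spread_le (rel_walk x c e) t (B e))
    \<and> measure_pmf.expectation (signs t) B \<le> real t + 20"
proof -
  have neg: "rel_walk (\<lambda>k. - x k) (- c) e = (\<lambda>s. - rel_walk x c e s)" for e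
    by (simp add: rel_walk_def fun_eq_iff)
  have down: "{k. - x (Suc k) - - x k = 1} = {k. x (Suc k) - x k = -1}" by auto
  consider "4 * t \<le> 5 * count_below {k. x (Suc k) - x k = 1} t"
    | "4 * t \<le> 5 * count_below {k. x (Suc k) - x k = -1} t"
    | "5 * count_below {k. x (Suc k) - x k = 1} t \<le> 4 * t"
      "5 * count_below {k. x (Suc k) - x k = -1} t \<le> 4 * t"
    by linarith
  then show ?thesis
  proof cases
    case 1
    then show ?thesis using spread_mostly_up[of t x c] x c by blast
  next
    case 2
    have "\<bar>- x (Suc k) - - x k\<bar> \<le> 1" if "k < t" for k using x[OF that] by linarith
    moreover have "- c = 1 \<or> - c = -1" using c by auto
    ultimately show ?thesis
      using spread_mostly_up[of t "\<lambda>k. - x k" "- c"] 2 unfolding down neg spread_le_uminus by blast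
  next
    case 3
    then show ?thesis using spread_balanced[of t x c] x c by blast
  qed
qed

section \<open>The cop configurations of a play\<close>

text \<open>The cops see only their own past, so their configurations form a process of their own.
  The list includes the initial configuration.\<close>

primrec cop_law :: "'v cop_strategy \<Rightarrow> 'v list \<Rightarrow> nat \<Rightarrow> 'v list list pmf" where
  "cop_law \<sigma> x 0 = return_pmf [x]"
| "cop_law \<sigma> x (Suc t) = bind_pmf (cop_law \<sigma> x t) (\<lambda>c. map_pmf (\<lambda>z. c @ [z]) (\<sigma> c))"

lemma length_cop_law: "c \<in> set_pmf (cop_law \<sigma> x t) \<Longrightarrow> length c = Suc t"
  by (induction t arbitrary: c) auto

lemma cop_law_0: "c \<in> set_pmf (cop_law \<sigma> x t) \<Longrightarrow> c ! 0 = x"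
proof (induction t arbitrary: c)
  case (Suc t)
  then obtain c' z where "c = c' @ [z]" "c' \<in> set_pmf (cop_law \<sigma> x t)" by auto
  with Suc.IH show ?case using length_cop_law[of c' \<sigma> x t] by (simp add: nth_append)
qed simp

lemma cop_law_step:
  assumes "\<sigma> \<in> cop_strategies G"
  shows "c \<in> set_pmf (cop_law \<sigma> x t) \<Longrightarrow> k < t \<Longrightarrow> c ! Suc k \<in> cop_moves G (c ! k)"
proof (induction t arbitrary: c)
  case (Suc t)
  then obtain c' z where c: "c = c' @ [z]" "c' \<in> set_pmf (cop_law \<sigma> x t)" "z \<in> set_pmf (\<sigma> c')"
    by auto
  have len: "length c' = Suc t" by (rule length_cop_law[OF c(2)])
  show ?case
  proof (cases "k = t")
    case True
    have "c' \<noteq> []" using len by auto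
    then have "z \<in> cop_moves G (last c')" using assms c(3) by (auto simp: cop_strategies_def)
    then show ?thesis using True len c(1) \<open>c' \<noteq> []\<close> by (simp add: nth_append last_conv_nth)
  next
    case False
    then show ?thesis using Suc.IH[OF c(2)] Suc.prems(2) len c(1) by (simp add: nth_append)
  qed
qed simp

section \<open>Lifting cop trajectories to the integers\<close>

definition lift_path :: "nat \<Rightarrow> (nat \<Rightarrow> nat) \<Rightarrow> nat \<Rightarrow> (nat \<Rightarrow> int) \<Rightarrow> bool" where
  "lift_path n f t x \<longleftrightarrow> (\<forall>s\<le>t. f s = vx n (x s)) \<and> (\<forall>s<t. \<bar>x (Suc s) - x s\<bar> \<le> 1)"

lemma lift_path_exists:
  assumes "0 < n" "f 0 = vx n z" "\<And>s. s < t \<Longrightarrow> f (Suc s) \<in> moves (cycle_graph n) (f s)"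
  shows "\<exists>x. lift_path n f t x \<and> x 0 = z"
  using assms(3)
proof (induction t)
  case 0
  show ?case by (rule exI[of _ "\<lambda>_. z"]) (simp add: lift_path_def assms)
next
  case (Suc t)
  then obtain x where x: "lift_path n f t x" "x 0 = z" by auto
  then have "f (Suc t) \<in> moves (cycle_graph n) (vx n (x t))"
    using Suc.prems[of t] by (simp add: lift_path_def)
  then obtain e where e: "f (Suc t) = vx n (x t + e)" "\<bar>e\<bar> \<le> 1"
    using assms(1) by (rule moves_vxE)
  show ?case
  proof (intro exI conjI)
    show "lift_path n f (Suc t) (x(Suc t := x t + e))"
      using x(1) e by (auto simp: lift_path_def le_Suc_eq less_Suc_eq)
  qed (simp add: x)
qed

lemma cop_law_pair:
  assumes "\<sigma> \<in> cop_strategies G" "c \<in> set_pmf (cop_law \<sigma> x t)" "length x = 2"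
  shows "s \<le> t \<Longrightarrow> length (c ! s) = 2"
    and "s < t \<Longrightarrow> i < 2 \<Longrightarrow> c ! Suc s ! i \<in> moves G (c ! s ! i)"
proof -
  have len: "length (c ! s) = 2" if "s \<le> t" for s
    using that
  proof (induction s)
    case 0
    then show ?case using cop_law_0[OF assms(2)] assms(3) by simp
  next
    case (Suc s)
    then show ?case using cop_law_step[OF assms(1,2), of s]
      by (auto simp: cop_moves_def dest: list_all2_lengthD)
  qed
  show "s \<le> t \<Longrightarrow> length (c ! s) = 2" by (rule len)
  show "s < t \<Longrightarrow> i < 2 \<Longrightarrow> c ! Suc s ! i \<in> moves G (c ! s ! i)"
    using cop_law_step[OF assms(1,2), of s] len[of s]
    by (auto simp: cop_moves_def list_all2_conv_all_nth)
qed

lemma set_length_2: "length xs = 2 \<Longrightarrow> set xs = {xs ! 0, xs ! 1}"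
  by (auto simp: numeral_2_eq_2 length_Suc_conv)

section \<open>The drunk robber survives for a long time\<close>

definition walk_from :: "nat \<Rightarrow> nat \<Rightarrow> (nat \<Rightarrow> int) \<Rightarrow> nat \<Rightarrow> nat" where
  "walk_from n y e s = vx n (int y + (\<Sum>k<s. e k))"

lemma walk_from_upd: "s \<le> t \<Longrightarrow> walk_from n y (e(t := b)) s = walk_from n y e s"
proof -
  assume "s \<le> t"
  then have "(\<Sum>k<s. (e(t := b)) k) = (\<Sum>k<s. e k)" by (intro sum.cong) auto
  then show ?thesis by (simp only: walk_from_def)
qed

lemma walk_from_Suc_upd:
  "0 < n \<Longrightarrow> walk_from n y (e(t := b)) (Suc t) = vx n (int (walk_from n y e t) + b)"
proof -
  assume "0 < n"
  have "(\<Sum>k<t. (e(t := b)) k) = (\<Sum>k<t. e k)" by (intro sum.cong) auto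
  then show ?thesis using \<open>0 < n\<close>
    by (simp add: walk_from_def vx_int_vx_add add.assoc del: fun_upd_apply) simp
qed

text \<open>Cop trajectory, starting vertex and signs are independent, since neither side observes
  the other.\<close>

lemma prefix_pmf_drunk:
  assumes n: "3 \<le> n"
  shows "prefix_pmf \<sigma> (drunk (cycle_graph n)) (map_pmf (Pair x) (pmf_of_set {..<n})) (Suc t) =
    bind_pmf (cop_law \<sigma> x t) (\<lambda>c. bind_pmf (pmf_of_set {..<n})
      (\<lambda>y. map_pmf (\<lambda>e. zip c (map (walk_from n y e) [0..<Suc t])) (signs t)))"
proof (induction t)
  case 0
  have "map_pmf (\<lambda>y. [(x, y)]) (pmf_of_set {..<n})
      = bind_pmf (pmf_of_set {..<n}) (\<lambda>y. return_pmf [(x, walk_from n y (\<lambda>_. 0) 0)])"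
    unfolding map_pmf_def using n
    by (intro bind_pmf_cong[OF refl]) (auto simp: walk_from_def vx_of_nat set_pmf_of_set lessThan_empty_iff)
  then show ?case
    by (simp add: bind_return_pmf round_pmf_def pmf.map_comp comp_def map_pmf_def[symmetric])
next
  case (Suc t)
  let ?u = "pmf_of_set {..<n}" and ?\<rho> = "drunk (cycle_graph n)"
  let ?\<mu> = "map_pmf (Pair x) ?u"
  let ?h = "\<lambda>c y e t. zip c (map (walk_from n y e) [0..<Suc t])"
  have next_round: "map_pmf (\<lambda>z. ?h c y e t @ [z]) (round_pmf \<sigma> ?\<rho> ?\<mu> (?h c y e t))
      = bind_pmf (\<sigma> c) (\<lambda>z. map_pmf (\<lambda>b. ?h (c @ [z]) y (e(t := b)) (Suc t)) coin)"
    if c: "c \<in> set_pmf (cop_law \<sigma> x t)" for c y e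
  proof -
    have len: "length c = Suc t" by (rule length_cop_law[OF c])
    then have ne: "?h c y e t \<noteq> []" by (cases c) auto
    have fst: "map fst (?h c y e t) = c" and snd: "map snd (?h c y e t) = map (walk_from n y e) [0..<Suc t]"
      using len by (simp_all del: upt_Suc)
    have last: "last (map snd (?h c y e t)) = walk_from n y e t"
      unfolding snd by simp
    have lt: "walk_from n y e t < n" using n by (simp add: walk_from_def vx_less)
    have ext: "?h c y e t @ [(z, vx n (int (walk_from n y e t) + b))] = ?h (c @ [z]) y (e(t := b)) (Suc t)" for z b
    proof -
      have "map (walk_from n y (e(t := b))) [0..<Suc (Suc t)]
          = map (walk_from n y e) [0..<Suc t] @ [vx n (int (walk_from n y e t) + b)]"
        using n by (simp add: walk_from_Suc_upd walk_from_upd)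
      then show ?thesis using len by (simp del: upt_Suc)
    qed
    have drunk: "?\<rho> X (map snd (?h c y e t)) = map_pmf (\<lambda>b. vx n (int (walk_from n y e t) + b)) coin" for X
      using drunk_cycle[OF n, of "map snd (?h c y e t)" X] lt unfolding last by simp
    show ?thesis
      unfolding round_pmf_def using ne
      by (simp only: if_False fst drunk map_bind_pmf pmf.map_comp comp_def ext)
  qed
  have "prefix_pmf \<sigma> ?\<rho> ?\<mu> (Suc (Suc t)) = bind_pmf (cop_law \<sigma> x t) (\<lambda>c. bind_pmf ?u (\<lambda>y.
      bind_pmf (signs t) (\<lambda>e. map_pmf (\<lambda>z. ?h c y e t @ [z]) (round_pmf \<sigma> ?\<rho> ?\<mu> (?h c y e t)))))"
    unfolding prefix_pmf.simps(2)[of _ _ _ "Suc t"] Suc.IH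
    by (simp only: bind_assoc_pmf bind_map_pmf)
  also have "\<dots> = bind_pmf (cop_law \<sigma> x t) (\<lambda>c. bind_pmf ?u (\<lambda>y. bind_pmf (signs t) (\<lambda>e.
      bind_pmf (\<sigma> c) (\<lambda>z. map_pmf (\<lambda>b. ?h (c @ [z]) y (e(t := b)) (Suc t)) coin))))"
    by (intro bind_pmf_cong[OF refl] next_round)
  \<comment> \<open>The new cop move depends on \<open>c\<close> alone and is drawn before the start
    and the signs.\<close>
  also have "\<dots> = bind_pmf (cop_law \<sigma> x t) (\<lambda>c. bind_pmf (\<sigma> c) (\<lambda>z. bind_pmf ?u (\<lambda>y.
      bind_pmf (signs t) (\<lambda>e. map_pmf (\<lambda>b. ?h (c @ [z]) y (e(t := b)) (Suc t)) coin))))"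
    by (subst (2) bind_commute_pmf, subst bind_commute_pmf) (rule refl)
  also have "\<dots> = bind_pmf (cop_law \<sigma> x (Suc t)) (\<lambda>c. bind_pmf ?u (\<lambda>y. map_pmf (\<lambda>e. ?h c y e (Suc t)) (signs (Suc t))))"
    by (simp only: cop_law.simps signs.simps bind_assoc_pmf bind_map_pmf map_bind_pmf pmf.map_comp comp_def)
  finally show ?case .
qed

text \<open>The hits lie between the minimum of \<open>w\<close> minus 1 and its maximum plus 1, an
  interval with range plus 3 integers; projection to the cycle can only identify points.\<close>

lemma card_hits_le:
  assumes "spread_le w t B"
  shows "finite {z. \<exists>s\<le>t. \<bar>z - w s\<bar> \<le> (1::int)}" (is "finite ?Z")
    and "real (card (vx n ` {z. \<exists>s\<le>t. \<bar>z - w s\<bar> \<le> (1::int)})) \<le> B + 3"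
proof -
  let ?m = "Min (w ` {..t})" and ?M = "Max (w ` {..t})"
  have sub: "?Z \<subseteq> {?m - 1..?M + 1}"
  proof
    fix z assume "z \<in> ?Z"
    then obtain s where s: "s \<le> t" "\<bar>z - w s\<bar> \<le> 1" by blast
    have "?m \<le> w s" "w s \<le> ?M" using s(1) by (auto intro!: Min_le Max_ge)
    with s(2) show "z \<in> {?m - 1..?M + 1}" unfolding atLeastAtMost_iff by linarith
  qed
  then show fin: "finite ?Z" by (rule finite_subset) simp
  obtain r s where rs: "r \<le> t" "s \<le> t" "w r = ?m" "w s = ?M"
  proof -
    have "?m \<in> w ` {..t}" "?M \<in> w ` {..t}" by (auto intro!: Min_in Max_in)
    then show thesis using that by (auto simp: image_iff)
  qed
  have "card (vx n ` ?Z) \<le> card {?m - 1..?M + 1}"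
    by (rule order_trans[OF card_image_le[OF fin] card_mono[OF finite_atLeastAtMost_int sub]])
  also have "card {a - 1..b + 1} = nat (b - a + 3)" for a b :: int by simp
  finally have "card (vx n ` ?Z) \<le> nat (?M - ?m + 3)" .
  then have "real (card (vx n ` ?Z)) \<le> real_of_int (?M - ?m) + 3"
  proof -
    assume "card (vx n ` ?Z) \<le> nat (?M - ?m + 3)"
    moreover have "?m \<le> ?M" unfolding rs(4)[symmetric] using rs(2) by (intro Min_le) auto
    ultimately have "int (card (vx n ` ?Z)) \<le> ?M - ?m + 3" by linarith
    then have "real_of_int (int (card (vx n ` ?Z))) \<le> real_of_int (?M - ?m + 3)"
      by (simp only: of_int_le_iff)
    then show ?thesis by simp
  qed
  also have "real_of_int (?M - ?m) \<le> B"
    using assms rs unfolding spread_le_def by metis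
  finally show "real (card (vx n ` ?Z)) \<le> B + 3" by simp
qed

text \<open>Translation invariance: subtracting the displacement of the walk turns a meeting in
  round \<open>r\<close> into a condition on the starting vertex.\<close>

lemma hit_iff_lift:
  assumes "0 < n" "y < n" "walk_from n y e r = vx n a" "\<bar>a - x r\<bar> \<le> 1" "r \<le> t"
  shows "y \<in> vx n ` {z. \<exists>s\<le>t. \<bar>z - rel_walk x (-1) e s\<bar> \<le> 1}"
proof (rule image_eqI)
  have "vx n (int y + (\<Sum>k<r. e k) + - (\<Sum>k<r. e k)) = vx n (a + - (\<Sum>k<r. e k))"
    using assms(1,3) by (intro vx_add_cong) (auto simp: walk_from_def)
  then show "y = vx n (a - (\<Sum>k<r. e k))" using assms(2) by (simp add: vx_of_nat)
  show "a - (\<Sum>k<r. e k) \<in> {z. \<exists>s\<le>t. \<bar>z - rel_walk x (-1) e s\<bar> \<le> 1}"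
    using assms(4,5) by (auto simp: rel_walk_def intro!: exI[of _ r])
qed

text \<open>If a cop moves onto the robber, the cop in round \<open>s\<close> is compared with the
  walk at \<open>s - 1\<close>. The cop was then within distance one, which explains the tolerance
  1.\<close>

lemma caught_imp_hit:
  assumes n: "0 < n" and y: "y < n"
    and len: "length c = Suc t" "\<And>s. s \<le> t \<Longrightarrow> length (c ! s) = 2"
    and a: "lift_path n (\<lambda>s. c ! s ! 0) t a" and b: "lift_path n (\<lambda>s. c ! s ! 1) t b"
    and caught: "\<not> uncaught (zip c (map (walk_from n y e) [0..<Suc t]))"
  shows "\<exists>x\<in>{a, b}. y \<in> vx n ` {z. \<exists>s\<le>t. \<bar>z - rel_walk x (-1) e s\<bar> \<le> 1}"
proof -
  have set: "set (c ! s) = {vx n (a s), vx n (b s)}" if "s \<le> t" for s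
    using set_length_2[OF len(2)[OF that]] a b that by (auto simp: lift_path_def)
  have ex: "\<exists>x\<in>{a, b}. w = vx n (x s)" if "w \<in> set (c ! s)" "s \<le> t" for w s
    using that(1) unfolding set[OF that(2)] by auto
  have close: "\<bar>x s - x (s - 1)\<bar> \<le> 1" if "x \<in> {a, b}" "0 < s" "s \<le> t" for x s
  proof -
    have "Suc (s - 1) = s" "s - 1 < t" using that by auto
    then show ?thesis using a b that(1) unfolding lift_path_def by (metis insertE singletonD)
  qed
  from caught obtain s where s: "s \<le> t"
    and "walk_from n y e s \<in> set (c ! s) \<or> 0 < s \<and> walk_from n y e (s - 1) \<in> set (c ! s)"
    unfolding uncaught_def using len(1)
    by (auto simp: less_Suc_eq_le simp del: upt_Suc)
  then show ?thesis
  proof (elim disjE conjE)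
    assume "walk_from n y e s \<in> set (c ! s)"
    then obtain x where "x \<in> {a, b}" "walk_from n y e s = vx n (x s)" using ex s by blast
    then show ?thesis using hit_iff_lift[OF n y, of e s "x s" x t] s by auto
  next
    assume pos: "0 < s" and "walk_from n y e (s - 1) \<in> set (c ! s)"
    then obtain x where x: "x \<in> {a, b}" "walk_from n y e (s - 1) = vx n (x s)" using ex s by blast
    then have "y \<in> vx n ` {z. \<exists>s\<le>t. \<bar>z - rel_walk x (-1) e s\<bar> \<le> 1}"
      using close[OF x(1) pos s] s by (intro hit_iff_lift[OF n y x(2)]) auto
    with x(1) show ?thesis by blast
  qed
qed

section \<open>Averaging over trajectories, signs and starting vertices\<close>

lemma prob_bind_ge:
  assumes "\<And>c. c \<in> set_pmf p \<Longrightarrow> q \<le> measure_pmf.prob (f c) A"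
  shows "q \<le> measure_pmf.prob (bind_pmf p f) A"
proof -
  have "ennreal q \<le> (\<integral>\<^sup>+c. ennreal q \<partial>measure_pmf p)" by simp
  also have "\<dots> \<le> (\<integral>\<^sup>+c. emeasure (measure_pmf (f c)) A \<partial>measure_pmf p)"
    by (rule nn_integral_mono_AE)
      (auto simp: AE_measure_pmf_iff measure_pmf.emeasure_eq_measure intro!: ennreal_leI assms)
  also have "\<dots> = emeasure (measure_pmf (bind_pmf p f)) A" by simp
  finally show ?thesis by (simp add: measure_pmf.emeasure_eq_measure)
qed

lemma prob_bind_signs:
  "measure_pmf.prob (bind_pmf (signs t) f) A = measure_pmf.expectation (signs t) (\<lambda>e. measure_pmf.prob (f e) A)"
proof -
  have "ennreal (measure_pmf.prob (bind_pmf (signs t) f) A)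
      = (\<integral>\<^sup>+e. ennreal (measure_pmf.prob (f e) A) \<partial>measure_pmf (signs t))"
    by (simp flip: measure_pmf.emeasure_eq_measure)
  also have "\<dots> = ennreal (measure_pmf.expectation (signs t) (\<lambda>e. measure_pmf.prob (f e) A))"
    by (rule nn_integral_eq_integral) auto
  finally show ?thesis by (simp add: integral_nonneg_AE)
qed

text \<open>A union bound over the two cops: each accounts for at most \<open>t + 20 + 3\<close>
  starting vertices in the mean, hence \<open>2 * t + 46\<close>.\<close>

lemma prob_uncaught_drunk_ge:
  assumes n: "3 \<le> n" and \<sigma>: "\<sigma> \<in> cop_strategies (cycle_graph n)"
    and x: "x \<in> placements (cycle_graph n) 2"
  shows "1 - (2 * real t + 46) / real n \<le> measure_pmf.prob
    (prefix_pmf \<sigma> (drunk (cycle_graph n)) (map_pmf (Pair x) (pmf_of_set {..<n})) (Suc t)) {h. uncaught h}"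
  unfolding prefix_pmf_drunk[OF n]
proof (rule prob_bind_ge)
  fix c assume c: "c \<in> set_pmf (cop_law \<sigma> x t)"
  have lx: "length x = 2" and vert: "set x \<subseteq> {..<n}" using x by (auto simp: placements_def cycle_graph_def)
  have lift: "\<exists>a. lift_path n (\<lambda>s. c ! s ! i) t a" if "i < 2" for i
  proof -
    have "x ! i \<in> set x" using that lx by simp
    then have "c ! 0 ! i < n" using vert unfolding cop_law_0[OF c] by blast
    then have "c ! 0 ! i = vx n (int (c ! 0 ! i))" by (simp add: vx_of_nat)
    then show ?thesis
      using lift_path_exists[of n "\<lambda>s. c ! s ! i" _ t] cop_law_pair(2)[OF \<sigma> c lx] that n by fastforce
  qed
  obtain a b where ab: "lift_path n (\<lambda>s. c ! s ! 0) t a" "lift_path n (\<lambda>s. c ! s ! 1) t b"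
    using lift[of 0] lift[of 1] by auto
  have ex: "\<exists>B. (\<forall>e\<in>set_pmf (signs t). spread_le (rel_walk f (-1) e) t (B e))
      \<and> measure_pmf.expectation (signs t) B \<le> real t + 20" if "lift_path n g t f" for f g
    by (rule expected_spread) (use that in \<open>auto simp: lift_path_def\<close>)
  obtain Ba where Ba: "\<And>e. e \<in> set_pmf (signs t) \<Longrightarrow> spread_le (rel_walk a (-1) e) t (Ba e)"
      "measure_pmf.expectation (signs t) Ba \<le> real t + 20"
    using ex[OF ab(1)] by blast
  obtain Bb where Bb: "\<And>e. e \<in> set_pmf (signs t) \<Longrightarrow> spread_le (rel_walk b (-1) e) t (Bb e)"
      "measure_pmf.expectation (signs t) Bb \<le> real t + 20"
    using ex[OF ab(2)] by blast
  let ?h = "\<lambda>y e. zip c (map (walk_from n y e) [0..<Suc t])"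
  have one: "1 - (Ba e + Bb e + 6) / real n \<le> measure_pmf.prob (map_pmf (\<lambda>y. ?h y e) (pmf_of_set {..<n})) {h. uncaught h}"
    if e: "e \<in> set_pmf (signs t)" for e
  proof -
    let ?Z = "\<lambda>f. vx n ` {z. \<exists>s\<le>t. \<bar>z - rel_walk f (-1) e s\<bar> \<le> 1}"
    let ?S = "{y. y < n \<and> uncaught (?h y e)}"
    have "{..<n} \<subseteq> ?S \<union> (?Z a \<union> ?Z b)"
      using caught_imp_hit[of n _ c t a b e] n length_cop_law[OF c] cop_law_pair(1)[OF \<sigma> c lx] ab
      by (auto simp del: upt_Suc)
    moreover have fin: "finite (?Z a)" "finite (?Z b)"
      using card_hits_le(1)[OF Ba(1)[OF e]] card_hits_le(1)[OF Bb(1)[OF e]] by auto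
    ultimately have "n \<le> card (?S \<union> (?Z a \<union> ?Z b))"
      using card_mono[of "?S \<union> (?Z a \<union> ?Z b)" "{..<n}"] by simp
    also have "\<dots> \<le> card ?S + (card (?Z a) + card (?Z b))"
      by (meson add_left_mono card_Un_le le_trans)
    finally have "real n \<le> real (card ?S) + (real (card (?Z a)) + real (card (?Z b)))" by linarith
    then have "real n - (Ba e + Bb e + 6) \<le> real (card ?S)"
      using card_hits_le(2)[OF Ba(1)[OF e], of n] card_hits_le(2)[OF Bb(1)[OF e], of n] by linarith
    then have "(real n - (Ba e + Bb e + 6)) / real n \<le> real (card ?S) / real n"
      by (rule divide_right_mono) simp
    then have "1 - (Ba e + Bb e + 6) / real n \<le> real (card ?S) / real n"
      using n unfolding diff_divide_distrib by simp
    also have "?S = {..<n} \<inter> {y. uncaught (?h y e)}" by auto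
    finally show ?thesis
      using n by (simp add: measure_pmf_of_set lessThan_empty_iff vimage_def del: upt_Suc)
  qed
  \<comment> \<open>For fixed signs only the start is random, so survival becomes a count of
    vertices; the signs are averaged afterwards.\<close>
  have swap: "bind_pmf (pmf_of_set {..<n}) (\<lambda>y. map_pmf (?h y) (signs t))
      = bind_pmf (signs t) (\<lambda>e. map_pmf (\<lambda>y. ?h y e) (pmf_of_set {..<n}))"
    unfolding map_pmf_def by (rule bind_commute_pmf)
  have "1 - (2 * real t + 46) / real n
      \<le> 1 - (measure_pmf.expectation (signs t) Ba + measure_pmf.expectation (signs t) Bb + 6) / real n"
    using Ba(2) Bb(2) by (intro diff_left_mono divide_right_mono) auto
  also have "\<dots> = measure_pmf.expectation (signs t) (\<lambda>e. 1 - (Ba e + Bb e + 6) / real n)"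
    by simp
  also have "\<dots> \<le> measure_pmf.expectation (signs t)
      (\<lambda>e. measure_pmf.prob (map_pmf (\<lambda>y. ?h y e) (pmf_of_set {..<n})) {h. uncaught h})"
    by (rule expectation_signs_mono[OF one])
  finally show "1 - (2 * real t + 46) / real n
      \<le> measure_pmf.prob (bind_pmf (pmf_of_set {..<n}) (\<lambda>y. map_pmf (?h y) (signs t))) {h. uncaught h}"
    unfolding swap prob_bind_signs .
qed

lemma expected_capture_time_ge:
  fixes \<sigma> :: "'v :: countable cop_strategy"
  assumes "\<And>t. t < m \<Longrightarrow> g t \<le> measure_pmf.prob (prefix_pmf \<sigma> \<rho> \<mu> (Suc t)) {h. uncaught h}"
  shows "ennreal (\<Sum>t<m. g t) \<le> expected_capture_time \<sigma> \<rho> \<mu>"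
proof -
  let ?p = "\<lambda>t. measure_pmf.prob (prefix_pmf \<sigma> \<rho> \<mu> (Suc t)) {h. uncaught h}"
  have "ennreal (\<Sum>t<m. g t) \<le> ennreal (\<Sum>t<m. ?p t)"
    using assms by (intro ennreal_leI sum_mono) auto
  also have "\<dots> = (\<Sum>t<m. ennreal (?p t))" by (rule sum_ennreal[symmetric]) simp
  also have "\<dots> \<le> (\<Sum>t. ennreal (?p t))" by (intro sum_le_suminf) auto
  finally show ?thesis unfolding expected_capture_time_eq_suminf .
qed

lemma idct_cycle_ge:
  assumes n: "4 \<le> n"
  shows "ennreal (real n / 4 - 23) \<le> idct (cycle_graph n)"
proof -
  let ?G = "cycle_graph n" and ?m = "n div 2"
  have verts: "verts ?G = {..<n}" by (simp add: cycle_graph_def)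
  have "ennreal (real n / 4 - 23) \<le> expected_capture_time \<sigma> (drunk ?G) (map_pmf (Pair x) (pmf_of_set (verts ?G)))"
    if "x \<in> placements ?G 2" "\<sigma> \<in> cop_strategies ?G" for x \<sigma>
  proof -
    have gen: "(\<Sum>t<m. 1 - (2 * real t + 46) / real n) = real m * (1 - (real m + 45) / real n)" for m
      using n by (induction m) (simp_all add: field_simps)
    have m: "real n - 1 \<le> 2 * real ?m" "2 * real ?m \<le> real n" by linarith+
    have "real n * (real n / 4 - 23) \<le> real ?m * (real n - real ?m - 45)"
    proof -
      \<comment> \<open>Rounding in \<open>n div 2\<close>: one of the two factors vanishes,
        according to the parity of \<open>n\<close>.\<close>
      have "0 \<le> (2 * real ?m - (real n - 1)) * (real n - 2 * real ?m)" using m by (intro mult_nonneg_nonneg) auto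
      moreover have "92 * real ?m \<le> 46 * real n" using m by simp
      ultimately have "real n * real n - 92 * real n \<le> 4 * (real ?m * (real n - real ?m - 45))"
        using m n by (simp add: algebra_simps)
      then show ?thesis by (simp add: algebra_simps)
    qed
    then have "real n / 4 - 23 \<le> real ?m * (1 - (real ?m + 45) / real n)"
      using n by (simp add: field_simps)
    then have "ennreal (real n / 4 - 23) \<le> ennreal (\<Sum>t<?m. 1 - (2 * real t + 46) / real n)"
      unfolding gen by (rule ennreal_leI)
    also have "\<dots> \<le> expected_capture_time \<sigma> (drunk ?G) (map_pmf (Pair x) (pmf_of_set (verts ?G)))"
      unfolding verts using that n by (intro expected_capture_time_ge prob_uncaught_drunk_ge) auto
    finally show ?thesis .
  qed
  then have "ennreal (real n / 4 - 23) \<le> idct_cops ?G 2"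
    unfolding idct_cops_def idct_from_def by (intro INF_greatest)
  then show ?thesis by (simp add: idct_def cop_number_cycle n)
qed

section \<open>The adversarial robber survives for a long time\<close>

text \<open>A memoryless rule that mentions neither lifts nor arcs. Staying put when no vertex is
  out of reach keeps it legal everywhere.\<close>

definition evade :: "'v graph \<Rightarrow> 'v list \<Rightarrow> 'v \<Rightarrow> 'v" where
  "evade G xs y =
     (if \<exists>y'\<in>moves G y. \<forall>u\<in>set xs. y' \<notin> moves G u
      then SOME y'. y' \<in> moves G y \<and> (\<forall>u\<in>set xs. y' \<notin> moves G u) else y)"

definition evader :: "'v graph \<Rightarrow> 'v robber_strategy" where
  "evader G X Y = return_pmf (evade G (last X) (last Y))"

lemma evade_in_moves: "evade G xs y \<in> moves G y"
proof (cases "\<exists>y'\<in>moves G y. \<forall>u\<in>set xs. y' \<notin> moves G u")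
  case True
  then have "\<exists>y'. y' \<in> moves G y \<and> (\<forall>u\<in>set xs. y' \<notin> moves G u)" by blast
  from someI_ex[OF this] show ?thesis using True by (simp add: evade_def)
next
  case False
  then have "evade G xs y = y" unfolding evade_def by (rule if_not_P)
  then show ?thesis by (simp add: moves_refl)
qed

lemma evade_safe:
  assumes "y' \<in> moves G y" "\<And>u. u \<in> set xs \<Longrightarrow> y' \<notin> moves G u" "u \<in> set xs"
  shows "evade G xs y \<notin> moves G u"
proof -
  have ex: "\<exists>y'. y' \<in> moves G y \<and> (\<forall>u\<in>set xs. y' \<notin> moves G u)" using assms by blast
  from someI_ex[OF this] ex show ?thesis using assms(3) by (auto simp: evade_def Bex_def)
qed

lemma evader_in_robber_strategies: "evader G \<in> robber_strategies G"
  by (simp add: robber_strategies_def evader_def evade_in_moves)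

lemma vx_add_period: "vx n (z + int n) = vx n z"
  by (simp add: vx_def)

text \<open>Distance at least two from the lifts \<open>p\<close>, \<open>p + n\<close>,
  \<open>q\<close> and \<open>q - n\<close> of the cops, so that the next cop move cannot catch the
  robber.\<close>

definition in_arc :: "nat \<Rightarrow> int \<Rightarrow> int \<Rightarrow> int \<Rightarrow> bool" where
  "in_arc n p q y \<longleftrightarrow> p + 2 \<le> y \<and> y \<le> p + int n - 2 \<and> q - int n + 2 \<le> y \<and> y \<le> q - 2"

text \<open>Since the cops may have crossed in the other arc, the gap \<open>q - p\<close> can exceed \<open>n\<close>; the robber
  is then between \<open>q - n\<close> and \<open>p + n\<close>.\<close>

lemma evade_step:
  assumes "4 \<le> n" and arc: "in_arc n p q y" and xs: "set xs = {vx n p', vx n q'}"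
    and step: "\<bar>p' - p\<bar> \<le> 1" "\<bar>q' - q\<bar> \<le> 1" and gap: "4 \<le> q' - p'" "q' - p' \<le> 2 * int n - 4"
  shows "vx n y \<notin> set xs"
    and "\<exists>y'. evade (cycle_graph n) xs (vx n y) = vx n y' \<and> in_arc n p' q' y'"
proof -
  have n: "0 < n" using assms by simp
  have y: "p' + 1 \<le> y" "y \<le> p' + int n - 1" "q' - int n + 1 \<le> y" "y \<le> q' - 1"
    using arc step unfolding in_arc_def by linarith+
  show "vx n y \<notin> set xs"
    unfolding xs using vx_neq[of p' y n] vx_neq[of y q' n] y by auto
  have safe: "vx n z \<notin> moves (cycle_graph n) u" if "in_arc n p' q' z" "u \<in> set xs" for z u
  proof -
    have "vx n z \<notin> moves (cycle_graph n) (vx n p')"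
      using that(1) by (intro not_in_moves_vx) (auto simp: in_arc_def)
    moreover have "vx n z \<notin> moves (cycle_graph n) (vx n (q' - int n))"
      using that(1) by (intro not_in_moves_vx) (auto simp: in_arc_def)
    ultimately show ?thesis using that(2) xs vx_add_period[of n "q' - int n"] by auto
  qed
  \<comment> \<open>The gap bounds say that \<open>[p' + 2, q' - 2]\<close> and
    \<open>[q' - n + 2, p' + n - 2]\<close> are nonempty, so a robber next to a cop has room to step
    away.\<close>
  have "\<exists>z. \<bar>z - y\<bar> \<le> 1 \<and> in_arc n p' q' z"
  proof (cases "y = p' + 1 \<or> y = q' - int n + 1")
    case True
    then show ?thesis using y gap assms(1)
      by (intro exI[of _ "y + 1"]) (auto simp: in_arc_def)
  next
    case False
    show ?thesis
    proof (cases "y = q' - 1 \<or> y = p' + int n - 1")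
      case True
      then show ?thesis using False y gap assms(1)
        by (intro exI[of _ "y - 1"]) (auto simp: in_arc_def)
    next
      case False
      then show ?thesis using \<open>\<not> (y = p' + 1 \<or> y = q' - int n + 1)\<close> y
        by (intro exI[of _ y]) (auto simp: in_arc_def)
    qed
  qed
  then obtain z where z: "\<bar>z - y\<bar> \<le> 1" "in_arc n p' q' z" by blast
  let ?w = "evade (cycle_graph n) xs (vx n y)"
  obtain e where e: "?w = vx n (y + e)" "\<bar>e\<bar> \<le> 1"
    using evade_in_moves n by (rule moves_vxE)
  have "?w \<notin> moves (cycle_graph n) u" if "u \<in> set xs" for u
    using evade_safe[OF vx_in_moves[OF n z(1)] safe[OF z(2)] that] by blast
  \<comment> \<open>The rule may have chosen a vertex other than \<open>z\<close>. Being out of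
    reach of every cop, it still lies in the same arc.\<close>
  then have far: "1 < \<bar>y + e - c\<bar>" if "vx n c \<in> set xs" for c
    using that vx_in_moves[OF n, of "y + e" c] e(1) by force
  have "1 < \<bar>y + e - p'\<bar>" "1 < \<bar>y + e - (p' + int n)\<bar>" "1 < \<bar>y + e - q'\<bar>" "1 < \<bar>y + e - (q' - int n)\<bar>"
    using xs vx_add_period[of n p'] vx_add_period[of n "q' - int n"] by (auto intro!: far)
  then have "in_arc n p' q' (y + e)"
    unfolding in_arc_def using y e(2) by linarith
  with e(1) show "\<exists>y'. ?w = vx n y' \<and> in_arc n p' q' y'" by blast
qed

text \<open>Both \<open>d\<close> and \<open>2 n - d\<close>, the lengths of the intervals that can
  enclose the robber, stay at least four.\<close>

definition gap_ok :: "nat \<Rightarrow> nat \<Rightarrow> (nat \<Rightarrow> int) \<Rightarrow> bool" where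
  "gap_ok n t d \<longleftrightarrow> (\<forall>s\<le>t. 4 \<le> d s \<and> d s \<le> 2 * int n - 4)"

text \<open>Iterates \<open>evade_step\<close>. The start is the first safe vertex beyond
  \<open>p 0\<close>; as \<open>q 0 - n\<close> is at most \<open>p 0\<close>, it is also clear of
  that lift of the second cop.\<close>

lemma evader_survives:
  assumes n: "4 \<le> n"
    and h: "h \<in> set_pmf (prefix_pmf \<sigma> (evader (cycle_graph n)) (return_pmf (x, vx n (p 0 + 2))) (Suc t))"
    and cops: "\<And>s. s \<le> t \<Longrightarrow> set (map fst h ! s) = {vx n (p s), vx n (q s)}"
    and step: "\<And>s. s < t \<Longrightarrow> \<bar>p (Suc s) - p s\<bar> \<le> 1 \<and> \<bar>q (Suc s) - q s\<bar> \<le> 1"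
    and gap: "gap_ok n t (\<lambda>s. q s - p s)" and gap0: "q 0 - p 0 \<le> int n"
  shows "uncaught h \<and> (\<exists>y. snd (last h) = vx n y \<and> in_arc n (p t) (q t) y)"
  using h cops step gap
proof (induction t arbitrary: h)
  case 0
  then have hx: "h = [(x, vx n (p 0 + 2))]" by (simp add: round_pmf_def)
  have arc: "in_arc n (p 0) (q 0) (p 0 + 2)"
    using 0(4) n gap0 by (auto simp: in_arc_def gap_ok_def)
  have "set x = {vx n (p 0), vx n (q 0)}" using 0(2)[of 0] hx by simp
  then have "vx n (p 0 + 2) \<notin> set x"
    using arc vx_neq[of "p 0" "p 0 + 2" n] vx_neq[of "p 0 + 2" "q 0" n] by (auto simp: in_arc_def)
  with hx arc show ?case by auto
next
  case (Suc t)
  from Suc.prems(1) obtain h' x' y' where h': "h = h' @ [(x', y')]"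
    "h' \<in> set_pmf (prefix_pmf \<sigma> (evader (cycle_graph n)) (return_pmf (x, vx n (p 0 + 2))) (Suc t))" "h' \<noteq> []"
    "y' \<in> set_pmf (evader (cycle_graph n) (map fst h' @ [x']) (map snd h'))"
    by (rule prefix_pmf_SucE)
  have len: "length h' = Suc t" by (rule length_prefix_pmf[OF h'(2)])
  have "set (map fst h' ! s) = {vx n (p s), vx n (q s)}" if "s \<le> t" for s
    using Suc.prems(2)[of s] that len h'(1) by (simp add: nth_append)
  moreover have "gap_ok n t (\<lambda>s. q s - p s)" using Suc.prems(4) by (simp add: gap_ok_def)
  ultimately obtain y where y: "uncaught h'" "snd (last h') = vx n y" "in_arc n (p t) (q t) y"
    using Suc.IH[OF h'(2)] Suc.prems(3) by auto
  have x': "set x' = {vx n (p (Suc t)), vx n (q (Suc t))}"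
    using Suc.prems(2)[of "Suc t"] len h'(1) by (simp add: nth_append)
  have y': "y' = evade (cycle_graph n) x' (vx n y)"
    using h'(3,4) y(2) by (simp add: evader_def last_map)
  have gapS: "4 \<le> q (Suc t) - p (Suc t)" "q (Suc t) - p (Suc t) \<le> 2 * int n - 4"
    using Suc.prems(4) by (auto simp: gap_ok_def)
  note st = evade_step[OF n y(3) x' conjunct1[OF Suc.prems(3)] conjunct2[OF Suc.prems(3)] gapS]
  obtain y'' where y'': "y' = vx n y''" "in_arc n (p (Suc t)) (q (Suc t)) y''"
    using st(2) y' by auto
  have "y' \<notin> set x'"
    using y'' vx_neq[of "p (Suc t)" y'' n] vx_neq[of y'' "q (Suc t)" n]
    unfolding x' by (auto simp: in_arc_def)
  moreover have "snd (last h') \<notin> set x'" using st(1) y(2) by simp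
  ultimately show ?case using y(1) h'(1,3) y'' by (auto simp: uncaught_snoc)
qed

text \<open>The right side does not mention the robber, so robbers in different arcs can be compared
  along the same cop trajectory.\<close>

lemma map_fst_prefix_pmf:
  "map_pmf (map fst) (prefix_pmf \<sigma> \<rho> (return_pmf (x, y)) (Suc t)) = cop_law \<sigma> x t"
proof (induction t)
  case 0
  show ?case by (simp add: bind_return_pmf round_pmf_def)
next
  case (Suc t)
  let ?P = "prefix_pmf \<sigma> \<rho> (return_pmf (x, y)) (Suc t)"
  have "map_pmf (map fst) (prefix_pmf \<sigma> \<rho> (return_pmf (x, y)) (Suc (Suc t)))
      = bind_pmf ?P (\<lambda>h. map_pmf (\<lambda>z. map fst h @ [fst z]) (round_pmf \<sigma> \<rho> (return_pmf (x, y)) h))"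
    unfolding prefix_pmf.simps(2)[of _ _ _ "Suc t"]
    by (simp only: map_bind_pmf pmf.map_comp comp_def map_append list.map)
  also have "\<dots> = bind_pmf ?P (\<lambda>h. map_pmf (\<lambda>z. map fst h @ [z]) (\<sigma> (map fst h)))"
  proof (rule bind_pmf_cong[OF refl])
    fix h assume "h \<in> set_pmf ?P"
    then have "h \<noteq> []" using length_prefix_pmf[of h] by fastforce
    then show "map_pmf (\<lambda>z. map fst h @ [fst z]) (round_pmf \<sigma> \<rho> (return_pmf (x, y)) h)
        = map_pmf (\<lambda>z. map fst h @ [z]) (\<sigma> (map fst h))"
      by (simp add: round_pmf_def map_bind_pmf pmf.map_comp comp_def map_pmf_const)
        (simp add: map_pmf_def)
  qed
  also have "\<dots> = bind_pmf (map_pmf (map fst) ?P) (\<lambda>c. map_pmf (\<lambda>z. c @ [z]) (\<sigma> c))"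
    by (simp only: bind_map_pmf)
  finally show ?case by (simp only: Suc.IH cop_law.simps)
qed

lemma cop_law_take: "t \<le> m \<Longrightarrow> map_pmf (take (Suc t)) (cop_law \<sigma> x m) = cop_law \<sigma> x t"
proof (induction m)
  case 0
  then show ?case by simp
next
  case (Suc m)
  show ?case
  proof (cases "t = Suc m")
    case True
    have "map_pmf (take (Suc t)) (cop_law \<sigma> x t) = map_pmf (\<lambda>c. c) (cop_law \<sigma> x t)"
      by (rule pmf.map_cong[OF refl]) (simp add: length_cop_law)
    with True show ?thesis by simp
  next
    case False
    have "map_pmf (take (Suc t)) (cop_law \<sigma> x (Suc m))
        = bind_pmf (cop_law \<sigma> x m) (\<lambda>c. map_pmf (\<lambda>z. take (Suc t) (c @ [z])) (\<sigma> c))"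
      by (simp add: map_bind_pmf pmf.map_comp comp_def)
    also have "\<dots> = bind_pmf (cop_law \<sigma> x m) (\<lambda>c. return_pmf (take (Suc t) c))"
      using False Suc.prems by (intro bind_pmf_cong[OF refl]) (simp add: length_cop_law map_pmf_const)
    also have "\<dots> = cop_law \<sigma> x t" using Suc False by (simp add: map_pmf_def)
    finally show ?thesis .
  qed
qed

text \<open>Sets instead of ordered pairs: the same configurations are also lifted by
  \<open>q\<close> and \<open>p + n\<close>, which describes the other arc.\<close>

definition lifted :: "nat \<Rightarrow> nat list list \<Rightarrow> nat \<Rightarrow> (nat \<Rightarrow> int) \<Rightarrow> (nat \<Rightarrow> int) \<Rightarrow> bool" where
  "lifted n c t p q \<longleftrightarrow> (\<forall>s\<le>t. set (c ! s) = {vx n (p s), vx n (q s)})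
     \<and> (\<forall>s<t. \<bar>p (Suc s) - p s\<bar> \<le> 1 \<and> \<bar>q (Suc s) - q s\<bar> \<le> 1)"

text \<open>Survival is implied by an event about the cops alone, so it can be measured under one
  law, \<open>cop_law \<sigma> x m\<close>, for all \<open>t\<close> and both starts.\<close>

lemma prob_uncaught_evader_ge:
  assumes n: "4 \<le> n" and z: "z' - z \<le> int n" and t: "t \<le> m"
  shows "measure_pmf.prob (cop_law \<sigma> x m)
      {c. \<exists>p q. lifted n (take (Suc t) c) t p q \<and> p 0 = z \<and> q 0 = z' \<and> gap_ok n t (\<lambda>s. q s - p s)}
    \<le> measure_pmf.prob (prefix_pmf \<sigma> (evader (cycle_graph n)) (return_pmf (x, vx n (z + 2))) (Suc t)) {h. uncaught h}"
proof -
  let ?S = "{c. \<exists>p q. lifted n c t p q \<and> p 0 = z \<and> q 0 = z' \<and> gap_ok n t (\<lambda>s. q s - p s)}"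
  let ?P = "prefix_pmf \<sigma> (evader (cycle_graph n)) (return_pmf (x, vx n (z + 2))) (Suc t)"
  have "measure_pmf.prob (cop_law \<sigma> x m) {c. take (Suc t) c \<in> ?S} = measure_pmf.prob (cop_law \<sigma> x t) ?S"
    unfolding cop_law_take[OF t, symmetric] by (simp add: vimage_def)
  also have "\<dots> = measure_pmf.prob ?P {h. map fst h \<in> ?S}"
    unfolding map_fst_prefix_pmf[of \<sigma> "evader (cycle_graph n)" x "vx n (z + 2)" t, symmetric]
    by (simp add: vimage_def del: prefix_pmf.simps)
  also have "\<dots> \<le> measure_pmf.prob ?P {h. uncaught h}"
  proof (rule measure_pmf.finite_measure_mono_AE)
    have "uncaught h" if h: "h \<in> set_pmf ?P" and "map fst h \<in> ?S" for h
    proof -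
      from that(2) obtain p q where pq: "lifted n (map fst h) t p q" "p 0 = z" "q 0 = z'"
          "gap_ok n t (\<lambda>s. q s - p s)" by blast
      show ?thesis
        using evader_survives[of n h \<sigma> x p t q] n h pq z by (auto simp: lifted_def)
    qed
    then show "AE h in ?P. h \<in> {h. map fst h \<in> ?S} \<longrightarrow> h \<in> {h. uncaught h}"
      by (auto simp: AE_measure_pmf_iff simp del: prefix_pmf.simps)
  qed simp
  finally show ?thesis by simp
qed

text \<open>Here \<open>d\<close> is the lifted distance between the cops. Two robbers start in the two arcs, with
  weights \<open>a\<close> and \<open>1 - a\<close>. When the first arc collapses, the second has length about \<open>n\<close>, so its
  robber survives for about \<open>n / 2\<close> further rounds.\<close>

lemma collapse_low:
  fixes d :: "nat \<Rightarrow> int"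
  assumes n: "8 \<le> n" and step: "\<And>s. s < n \<Longrightarrow> \<bar>d (Suc s) - d s\<bar> \<le> 2"
    and \<tau>: "\<tau> < n" "\<And>s. s < \<tau> \<Longrightarrow> 4 \<le> d s \<and> d s \<le> int n - 4" "0 \<le> d \<tau>" "d \<tau> \<le> 3"
    and a: "0 \<le> a" "a \<le> 1" "a \<le> of_int (d 0) / real n" and d0: "d 0 \<le> int n"
  shows "real n / 2 - 5 \<le> (\<Sum>t<n. a * of_bool (gap_ok n t d) + (1 - a) * of_bool (gap_ok n t (\<lambda>s. int n - d s)))"
    (is "_ \<le> sum ?f _")
proof -
  have before: "?f t = 1" if "t < \<tau>" for t
  proof -
    have "4 \<le> d s \<and> d s \<le> int n - 4" if "s \<le> t" for s
      using \<tau>(2)[of s] \<open>t < \<tau>\<close> that by simp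
    then have "gap_ok n t d" "gap_ok n t (\<lambda>s. int n - d s)"
      unfolding gap_ok_def by fastforce+
    then show ?thesis by simp
  qed
  have nonneg: "0 \<le> ?f t" for t using a by simp
  show ?thesis
  proof (cases "n \<le> 2 * \<tau>")
    case True
    have "real n / 2 - 5 \<le> (\<Sum>t<\<tau>. ?f t)" using True before by simp
    also have "\<dots> \<le> sum ?f {..<n}" using \<tau>(1) nonneg by (intro sum_mono2) auto
    finally show ?thesis .
  next
    case False
    \<comment> \<open>For \<open>k < m\<close> one has \<open>2 * k \<le> n - 7\<close>, so within
      \<open>k\<close> rounds \<open>d\<close> rises from at most 3 to at most \<open>n - 4\<close>,
      and the second arc is still safe.\<close>
    define m where "m = (n - 5) div 2"
    have m: "\<tau> + m \<le> n" "n \<le> 2 * m + 6" "2 * m \<le> n - 5" using False n unfolding m_def by linarith+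
    have drift: "\<bar>d (\<tau> + k) - d \<tau>\<bar> \<le> 2 * int k" if "\<tau> + k \<le> n" for k
      using that
    proof (induction k)
      case (Suc k)
      then show ?case using step[of "\<tau> + k"] by simp
    qed simp
    have after: "1 - a \<le> ?f t" if "\<tau> \<le> t" "t < \<tau> + m" for t
    proof -
      have "4 \<le> int n - d s \<and> int n - d s \<le> 2 * int n - 4" if "s \<le> t" for s
      proof (cases "s < \<tau>")
        case True
        then show ?thesis using \<tau>(2)[OF True] n by linarith
      next
        case False
        then obtain k where k: "s = \<tau> + k" by (metis le_add_diff_inverse not_less)
        have "k + 1 \<le> m" using k \<open>s \<le> t\<close> \<open>t < \<tau> + m\<close> by simp
        then have "2 * int k \<le> int n - 7" using m(3) n by linarith
        moreover have "\<bar>d s - d \<tau>\<bar> \<le> 2 * int k"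
          unfolding k using \<open>k + 1 \<le> m\<close> m(1) by (intro drift) simp
        ultimately show ?thesis using \<tau>(3,4) n by linarith
      qed
      then have "gap_ok n t (\<lambda>s. int n - d s)" by (simp add: gap_ok_def)
      then show ?thesis using a by simp
    qed
    have "\<bar>d s - d 0\<bar> \<le> 2 * int s" if "s \<le> \<tau>" for s
      using that
    proof (induction s)
      case (Suc s)
      then show ?case using step[of s] \<tau>(1) by simp
    qed simp
    from this[of \<tau>] have "d 0 \<le> 2 * int \<tau> + 3" using \<tau>(4) by simp
    then have \<tau>': "real_of_int (d 0) \<le> 2 * real \<tau> + 3" by linarith
    have "0 \<le> of_int (d 0) / real n" using a by linarith
    then have d0': "0 \<le> real_of_int (d 0)" using n by (simp add: zero_le_divide_iff)
    \<comment> \<open>The proportional weight makes \<open>d 0\<close> cancel: the time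
      \<open>\<tau>\<close> gives at least \<open>(d 0 - 3) / 2\<close> and the second arc at least
      \<open>(n - 6 - d 0) / 2\<close>.\<close>
    have "(real n - 6) * (1 - of_int (d 0) / real n) \<le> (2 * real m) * (1 - a)"
      using m a d0 n by (intro mult_mono) auto
    moreover have "(real n - 6) * (1 - of_int (d 0) / real n) = real n - 6 - of_int (d 0) + 6 * (of_int (d 0) / real n)"
      using n by (simp add: field_simps)
    moreover have "0 \<le> 6 * (of_int (d 0) / real n)" using d0' by simp
    ultimately have "real n - 6 - of_int (d 0) \<le> 2 * (real m * (1 - a))" by linarith
    then have "real n / 2 - 5 \<le> real \<tau> + real m * (1 - a)" using \<tau>' by linarith
    also have "\<dots> = (\<Sum>t<\<tau>. ?f t) + (\<Sum>t\<in>{\<tau>..<\<tau> + m}. 1 - a)"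
      using before by simp
    also have "\<dots> \<le> (\<Sum>t<\<tau>. ?f t) + (\<Sum>t\<in>{\<tau>..<\<tau> + m}. ?f t)"
      using after by (intro add_left_mono sum_mono) auto
    also have "\<dots> = (\<Sum>t\<in>{..<\<tau>} \<union> {\<tau>..<\<tau> + m}. ?f t)"
      by (intro sum.union_disjoint[symmetric]) auto
    also have "\<dots> \<le> sum ?f {..<n}"
      using \<tau>(1) m(1) nonneg by (intro sum_mono2) auto
    finally show ?thesis .
  qed
qed

text \<open>At the first collapse of either arc \<open>collapse_low\<close> applies, if necessary
  after exchanging the arcs by \<open>d \<mapsto> n - d\<close> and
  \<open>a \<mapsto> 1 - a\<close>. The weight is set to 0 or 1 when an arc is too short to start
  in.\<close>

lemma survival_sum:
  fixes d :: "nat \<Rightarrow> int"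
  assumes n: "8 \<le> n" and step: "\<And>s. s < n \<Longrightarrow> \<bar>d (Suc s) - d s\<bar> \<le> 2"
    and d0: "0 \<le> d 0" "d 0 \<le> int n"
    and a: "a = (if d 0 \<le> 3 then 0 else if int n - 3 \<le> d 0 then 1 else of_int (d 0) / real n)"
  shows "real n / 2 - 5 \<le> (\<Sum>t<n. a * of_bool (gap_ok n t d) + (1 - a) * of_bool (gap_ok n t (\<lambda>s. int n - d s)))"
proof (cases "\<forall>s<n. 4 \<le> d s \<and> d s \<le> int n - 4")
  case True
  then have "gap_ok n t d \<and> gap_ok n t (\<lambda>s. int n - d s)" if "t < n" for t
  proof -
    have "4 \<le> d s \<and> d s \<le> int n - 4" if "s \<le> t" for s
      using True \<open>t < n\<close> that by simp
    then show ?thesis unfolding gap_ok_def by fastforce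
  qed
  then show ?thesis by simp
next
  case False
  have a01: "0 \<le> a" "a \<le> 1" using a d0 n by (auto simp: divide_le_eq)
  define \<tau> where "\<tau> = (LEAST s. \<not> (4 \<le> d s \<and> d s \<le> int n - 4))"
  from False obtain s where s: "s < n" "\<not> (4 \<le> d s \<and> d s \<le> int n - 4)" by blast
  have \<tau>: "\<not> (4 \<le> d \<tau> \<and> d \<tau> \<le> int n - 4)"
    unfolding \<tau>_def by (rule LeastI[of "\<lambda>s. \<not> (4 \<le> d s \<and> d s \<le> int n - 4)", OF s(2)])
  have \<tau>n: "\<tau> < n"
    using Least_le[of "\<lambda>s. \<not> (4 \<le> d s \<and> d s \<le> int n - 4)", OF s(2)] s(1) unfolding \<tau>_def by simp
  have before: "4 \<le> d s \<and> d s \<le> int n - 4" if "s < \<tau>" for s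
    using not_less_Least that unfolding \<tau>_def by blast
  \<comment> \<open>A gap between 4 and \<open>n - 4\<close> cannot leave the range from 0 to
    \<open>n\<close> in one step of size at most 2.\<close>
  have range: "0 \<le> d \<tau> \<and> d \<tau> \<le> int n"
  proof (cases \<tau>)
    case 0
    then show ?thesis using d0 by simp
  next
    case (Suc k)
    then show ?thesis using step[of k] before[of k] \<tau>n n by auto
  qed
  show ?thesis
  proof (cases "d \<tau> \<le> 3")
    case True
    \<comment> \<open>Only a first gap of at least \<open>n - 3\<close> could give too large a
      weight; then the other arc collapses at time 0, contrary to
      \<open>d \<tau> \<le> 3\<close>.\<close>
    have "a \<le> of_int (d 0) / real n"
    proof (cases "d 0 \<le> 3 \<or> d 0 < int n - 3")
      case True
      then show ?thesis using a d0 by auto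
    next
      case F: False
      then have "\<tau> = 0" using before[of 0] n by (cases \<tau>) auto
      with F True show ?thesis by simp
    qed
    then show ?thesis
      using collapse_low[of n d \<tau> a] n step \<tau>n before range True a01 d0 by blast
  next
    case False
    then have high: "int n - 3 \<le> d \<tau>" using \<tau> by linarith
    have eq: "1 - of_int (d 0) / real n = of_int (int n - d 0) / real n"
      using n by (simp add: field_simps)
    have "1 - a \<le> of_int (int n - d 0) / real n"
    proof (cases "3 < d 0")
      case True
      then show ?thesis using a d0 unfolding eq[symmetric] by auto
    next
      case F: False
      then have "\<tau> = 0" using before[of 0] by (cases \<tau>) auto
      with F high n show ?thesis by simp
    qed
    moreover have "\<bar>(int n - d (Suc s)) - (int n - d s)\<bar> \<le> 2" if "s < n" for s
      using step[OF that] by linarith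
    moreover have "4 \<le> int n - d s \<and> int n - d s \<le> int n - 4" if "s < \<tau>" for s
      using before[OF that] by linarith
    ultimately have "real n / 2 - 5 \<le> (\<Sum>t<n. (1 - a) * of_bool (gap_ok n t (\<lambda>s. int n - d s))
        + (1 - (1 - a)) * of_bool (gap_ok n t (\<lambda>s. int n - (int n - d s))))"
      using collapse_low[of n "\<lambda>s. int n - d s" \<tau> "1 - a"] n \<tau>n range high a01 d0 by auto
    then show ?thesis by (simp add: add.commute)
  qed
qed

section \<open>From single trajectories to expected capture times\<close>

lemma weighted_indicators:
  fixes a b :: real
  shows "integrable (measure_pmf p) (\<lambda>c. \<Sum>t\<in>I. a * indicator (A t) c + b * indicator (B t) c)"
    and "measure_pmf.expectation p (\<lambda>c. \<Sum>t\<in>I. a * indicator (A t) c + b * indicator (B t) c)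
      = (\<Sum>t\<in>I. a * measure_pmf.prob p (A t) + b * measure_pmf.prob p (B t))"
proof -
  have ind: "integrable (measure_pmf p) (\<lambda>c. a * indicator S c)" for S and a :: real
    by (intro integrable_mult_right integrable_real_indicator) (auto simp: measure_pmf.emeasure_eq_measure)
  then have add: "integrable (measure_pmf p) (\<lambda>c. a * indicator (A t) c + b * indicator (B t) c)" for t
    by (intro Bochner_Integration.integrable_add)
  then show "integrable (measure_pmf p) (\<lambda>c. \<Sum>t\<in>I. a * indicator (A t) c + b * indicator (B t) c)"
    by (intro Bochner_Integration.integrable_sum)
  have "measure_pmf.expectation p (\<lambda>c. \<Sum>t\<in>I. a * indicator (A t) c + b * indicator (B t) c)
      = (\<Sum>t\<in>I. measure_pmf.expectation p (\<lambda>c. a * indicator (A t) c + b * indicator (B t) c))"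
    by (rule Bochner_Integration.integral_sum[OF add])
  also have "\<dots> = (\<Sum>t\<in>I. a * measure_pmf.prob p (A t) + b * measure_pmf.prob p (B t))"
    by (intro sum.cong refl) (simp add: Bochner_Integration.integral_add[OF ind ind])
  finally show "measure_pmf.expectation p (\<lambda>c. \<Sum>t\<in>I. a * indicator (A t) c + b * indicator (B t) c)
      = (\<Sum>t\<in>I. a * measure_pmf.prob p (A t) + b * measure_pmf.prob p (B t))" .
qed

lemma ict_cycle_ge:
  assumes n: "8 \<le> n"
  shows "ennreal (real n / 2 - 5) \<le> ict (cycle_graph n)"
proof -
  let ?G = "cycle_graph n"
  have "ennreal (real n / 2 - 5) \<le> (SUP y\<in>verts ?G. ict_against ?G \<sigma> x y)"
    if x: "x \<in> placements ?G 2" and \<sigma>: "\<sigma> \<in> cop_strategies ?G" for x \<sigma>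
  proof -
    have lx: "length x = 2" and vert: "set x \<subseteq> {..<n}" using x by (auto simp: placements_def cycle_graph_def)
    have xi: "x ! i < n" if "i < 2" for i
    proof -
      have "x ! i \<in> set x" using that lx by simp
      with vert show ?thesis by blast
    qed
    define z where "z = int (x ! 0)"
    have x0: "x ! 0 = vx n z" using xi[of 0] by (simp add: z_def vx_of_nat)
    obtain z' where z': "x ! 1 = vx n z'" "z \<le> z'" "z' < z + int n"
      using lift_exists[OF xi[of 1]] by auto
    define a where "a = (if z' - z \<le> 3 then 0 else if int n - 3 \<le> z' - z then 1 else of_int (z' - z) / real n)"
    have a01: "0 \<le> a" "a \<le> 1" using z' n unfolding a_def by (auto simp: divide_le_eq)
    define u where "u y t = measure_pmf.prob (prefix_pmf \<sigma> (evader ?G) (return_pmf (x, y)) (Suc t)) {h. uncaught h}" for y t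
    let ?y1 = "vx n (z + 2)" and ?y2 = "vx n (z' + 2)"
    let ?S = "\<lambda>z z' t. {c. \<exists>p q. lifted n (take (Suc t) c) t p q \<and> p 0 = z \<and> q 0 = z' \<and> gap_ok n t (\<lambda>s. q s - p s)}"
    let ?C = "cop_law \<sigma> x n"
    \<comment> \<open>The estimate holds for every trajectory, with a weight fixed by the initial
      configuration; randomised cops therefore gain nothing.\<close>
    have path: "real n / 2 - 5 \<le> (\<Sum>t<n. a * indicator (?S z z' t) c + (1 - a) * indicator (?S z' (z + int n) t) c)"
      if c: "c \<in> set_pmf ?C" for c
    proof -
      have ex: "\<exists>f. lift_path n (\<lambda>s. c ! s ! i) n f \<and> f 0 = w" if "i < 2" "x ! i = vx n w" for i w
        using lift_path_exists[of n "\<lambda>s. c ! s ! i" w n] cop_law_pair(2)[OF \<sigma> c lx] cop_law_0[OF c] that n by auto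
      obtain p q where p: "lift_path n (\<lambda>s. c ! s ! 0) n p" "p 0 = z"
          and q: "lift_path n (\<lambda>s. c ! s ! 1) n q" "q 0 = z'"
        using ex[of 0 z] ex[of 1 z'] x0 z'(1) by auto
      have set: "set (c ! s) = {vx n (p s), vx n (q s)}" if "s \<le> n" for s
        using set_length_2[OF cop_law_pair(1)[OF \<sigma> c lx that]] p q that by (simp add: lift_path_def)
      have l1: "lifted n (take (Suc t) c) t p q" if "t < n" for t
        using set p q that by (auto simp: lifted_def lift_path_def)
      have l2: "lifted n (take (Suc t) c) t q (\<lambda>s. p s + int n)" if "t < n" for t
        using set p q that by (auto simp: lifted_def lift_path_def vx_add_period insert_commute)
      let ?d = "\<lambda>s. q s - p s"
      have "\<bar>?d (Suc s) - ?d s\<bar> \<le> 2" if "s < n" for s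
      proof -
        have "\<bar>p (Suc s) - p s\<bar> \<le> 1" "\<bar>q (Suc s) - q s\<bar> \<le> 1"
          using p q that by (auto simp: lift_path_def)
        then show ?thesis by linarith
      qed
      then have "real n / 2 - 5 \<le> (\<Sum>t<n. a * of_bool (gap_ok n t ?d) + (1 - a) * of_bool (gap_ok n t (\<lambda>s. int n - ?d s)))"
        using z' p(2) q(2) by (intro survival_sum n) (auto simp: a_def)
      also have "\<dots> \<le> (\<Sum>t<n. a * indicator (?S z z' t) c + (1 - a) * indicator (?S z' (z + int n) t) c)"
      proof (intro sum_mono add_mono mult_left_mono)
        fix t assume "t \<in> {..<n}"
        then have t: "t < n" by simp
        show "of_bool (gap_ok n t ?d) \<le> (indicator (?S z z' t) c :: real)"
          using l1[OF t] p(2) q(2) by (auto simp: indicator_def)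
        have flip: "(\<lambda>s. int n - ?d s) = (\<lambda>s. (p s + int n) - q s)" by auto
        have "c \<in> ?S z' (z + int n) t" if "gap_ok n t (\<lambda>s. (p s + int n) - q s)"
          using l2[OF t] p(2) q(2) that
          by (intro CollectI exI[of _ q] exI[of _ "\<lambda>s. p s + int n"]) simp
        then show "of_bool (gap_ok n t (\<lambda>s. int n - ?d s)) \<le> (indicator (?S z' (z + int n) t) c :: real)"
          unfolding flip by (cases "gap_ok n t (\<lambda>s. (p s + int n) - q s)") (simp_all only: indicator_simps of_bool_eq order_refl indicator_pos_le)
      qed (use a01 in auto)
      finally show ?thesis .
    qed
    have "real n / 2 - 5 = measure_pmf.expectation ?C (\<lambda>_. real n / 2 - 5)" by simp
    also have "\<dots> \<le> measure_pmf.expectation ?C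
        (\<lambda>c. \<Sum>t<n. a * indicator (?S z z' t) c + (1 - a) * indicator (?S z' (z + int n) t) c)"
    proof (rule integral_mono_AE)
      show "integrable (measure_pmf ?C)
          (\<lambda>c. \<Sum>t<n. a * indicator (?S z z' t) c + (1 - a) * indicator (?S z' (z + int n) t) c)"
        by (rule weighted_indicators)
    qed (auto simp: AE_measure_pmf_iff path)
    also have "\<dots> = (\<Sum>t<n. a * measure_pmf.prob ?C (?S z z' t) + (1 - a) * measure_pmf.prob ?C (?S z' (z + int n) t))"
      by (rule weighted_indicators)
    also have "\<dots> \<le> (\<Sum>t<n. a * u ?y1 t + (1 - a) * u ?y2 t)"
    proof (intro sum_mono add_mono mult_left_mono)
      fix t assume t: "t \<in> {..<n}"
      show "measure_pmf.prob ?C (?S z z' t) \<le> u ?y1 t"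
        unfolding u_def using t z' n by (intro prob_uncaught_evader_ge) auto
      show "measure_pmf.prob ?C (?S z' (z + int n) t) \<le> u ?y2 t"
        unfolding u_def using t z' n by (intro prob_uncaught_evader_ge) auto
    qed (use a01 in auto)
    also have "\<dots> = a * (\<Sum>t<n. u ?y1 t) + (1 - a) * (\<Sum>t<n. u ?y2 t)"
      by (simp add: sum.distrib sum_distrib_left)
    finally have "real n / 2 - 5 \<le> a * (\<Sum>t<n. u ?y1 t) + (1 - a) * (\<Sum>t<n. u ?y2 t)" .
    \<comment> \<open>A weighted average is at most the maximum, which yields one deterministic
      starting vertex.\<close>
    moreover have "a * s + (1 - a) * r \<le> max s r" for s r :: real
      using convex_bound_le[of s "max s r" r a "1 - a"] a01 by simp
    ultimately have "real n / 2 - 5 \<le> max (\<Sum>t<n. u ?y1 t) (\<Sum>t<n. u ?y2 t)"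
      by (rule order_trans)
    then obtain y where y: "y \<in> {?y1, ?y2}" "real n / 2 - 5 \<le> (\<Sum>t<n. u y t)"
      by (auto simp: le_max_iff_disj)
    have "ennreal (real n / 2 - 5) \<le> ennreal (\<Sum>t<n. u y t)" using y(2) by (rule ennreal_leI)
    also have "\<dots> \<le> expected_capture_time \<sigma> (evader ?G) (return_pmf (x, y))"
      by (rule expected_capture_time_ge) (simp add: u_def)
    also have "\<dots> \<le> ict_against ?G \<sigma> x y"
      unfolding ict_against_def by (intro SUP_upper evader_in_robber_strategies)
    also have "\<dots> \<le> (SUP y\<in>verts ?G. ict_against ?G \<sigma> x y)"
      using y(1) n vx_less[of n] by (intro SUP_upper) (auto simp: cycle_graph_def)
    finally show ?thesis .
  qed
  then have "ennreal (real n / 2 - 5) \<le> ict_cops ?G 2"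
    unfolding ict_cops_def ict_from_def by (intro INF_greatest)
  then show ?thesis using n by (simp add: ict_def cop_number_cycle)
qed

section \<open>Asymptotics\<close>

lemma ennreal_between:
  assumes "ennreal a \<le> e" "e \<le> ennreal b" "0 \<le> a" "0 \<le> b"
  shows "e = ennreal (enn2real e)" "a \<le> enn2real e" "enn2real e \<le> b"
proof -
  obtain r where r: "e = ennreal r" "0 \<le> r"
    using assms(2) by (cases e) (auto simp: top_unique)
  then show "e = ennreal (enn2real e)" "a \<le> enn2real e" using assms(1) by auto
  show "enn2real e \<le> b" using assms r by auto
qed

lemma tendsto_of_linear_bounds:
  assumes "eventually (\<lambda>n. c * real n - d \<le> f n \<and> f n \<le> c * real n) sequentially"
  shows "(\<lambda>n. f n / real n) \<longlonglongrightarrow> c"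
proof (rule tendsto_sandwich)
  have ev: "eventually (\<lambda>n. 0 < n \<and> c * real n - d \<le> f n \<and> f n \<le> c * real n) sequentially"
    using eventually_conj[OF eventually_gt_at_top[of 0] assms] .
  show "eventually (\<lambda>n. c - d / real n \<le> f n / real n) sequentially"
    using ev
  proof eventually_elim
    case (elim n)
    then have "(c * real n - d) / real n \<le> f n / real n" by (intro divide_right_mono) auto
    then show ?case using elim by (simp add: diff_divide_distrib)
  qed
  show "eventually (\<lambda>n. f n / real n \<le> c) sequentially"
    using ev by eventually_elim (simp add: field_simps)
  show "(\<lambda>n. c - d / real n) \<longlonglongrightarrow> c"
    using tendsto_diff[OF tendsto_const lim_const_over_n] by simp
qed simp

text \<open>Beyond 92 the lower bound \<open>n / 4 - 23\<close> is positive; up to there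
  \<open>ennreal\<close> truncates it to 0.\<close>

lemma idct_cycle_bounds:
  assumes "92 < n"
  shows "idct (cycle_graph n) = ennreal (enn2real (idct (cycle_graph n)))"
    and "real n / 4 - 23 \<le> enn2real (idct (cycle_graph n))"
    and "enn2real (idct (cycle_graph n)) \<le> (real n - 1) / 4"
proof -
  note bounds = ennreal_between[OF idct_cycle_ge idct_cycle_le, of n]
  from assms show "idct (cycle_graph n) = ennreal (enn2real (idct (cycle_graph n)))"
    "real n / 4 - 23 \<le> enn2real (idct (cycle_graph n))"
    "enn2real (idct (cycle_graph n)) \<le> (real n - 1) / 4"
    by (intro bounds; simp)+
qed

lemma ict_cycle_bounds:
  assumes "92 < n"
  shows "ict (cycle_graph n) = ennreal (enn2real (ict (cycle_graph n)))"
    and "real n / 2 - 5 \<le> enn2real (ict (cycle_graph n))"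
    and "enn2real (ict (cycle_graph n)) \<le> real n / 2"
proof -
  note bounds = ennreal_between[OF ict_cycle_ge ict_cycle_le, of n]
  from assms show "ict (cycle_graph n) = ennreal (enn2real (ict (cycle_graph n)))"
    "real n / 2 - 5 \<le> enn2real (ict (cycle_graph n))"
    "enn2real (ict (cycle_graph n)) \<le> real n / 2"
    by (intro bounds; simp)+
qed

lemma idct_cycle_limit: "(\<lambda>n. enn2real (idct (cycle_graph n)) / real n) \<longlonglongrightarrow> 1 / 4"
  by (rule tendsto_of_linear_bounds[where d=23], rule eventually_mono[OF eventually_gt_at_top[of 92]])
    (use idct_cycle_bounds in force)

lemma ict_cycle_limit: "(\<lambda>n. enn2real (ict (cycle_graph n)) / real n) \<longlonglongrightarrow> 1 / 2"
  by (rule tendsto_of_linear_bounds[where d=5], rule eventually_mono[OF eventually_gt_at_top[of 92]])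
    (use ict_cycle_bounds in force)

theorem theorem6p4:
  shows "(\<exists>g :: nat \<Rightarrow> real. g \<in> O(\<lambda>n. ln (real n) / real n) \<and>
           (\<forall>n\<ge>4. ennreal (real n / 4 * (1 - g n)) \<le> idct (cycle_graph n)))
       \<and> (\<forall>n\<ge>4. idct (cycle_graph n) \<le> ennreal ((real n - 1) / 4))
       \<and> (\<lambda>n. enn2real (idct (cycle_graph n))) \<sim>[sequentially] (\<lambda>n. real n / 4)
       \<and> (\<lambda>n. cost_of_drunkenness (cycle_graph n)) \<longlonglongrightarrow> 2"
proof (intro conjI allI impI)
  show "\<exists>g :: nat \<Rightarrow> real. g \<in> O(\<lambda>n. ln (real n) / real n) \<and>
      (\<forall>n\<ge>4. ennreal (real n / 4 * (1 - g n)) \<le> idct (cycle_graph n))"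
  proof (intro exI conjI allI impI)
    \<comment> \<open>The constant is \<open>4 * 23\<close>, and \<open>1 / n\<close> is at most
      \<open>ln n / n\<close> from \<open>n = 3\<close> on.\<close>
    show "(\<lambda>n. 92 / real n) \<in> O(\<lambda>n. ln (real n) / real n)"
    proof (rule bigoI[where c=92], rule eventually_mono[OF eventually_ge_at_top[of 3]])
      fix n :: nat assume n: "3 \<le> n"
      then have "exp 1 \<le> real n" using exp_le by linarith
      then have "1 \<le> ln (real n)" using n by (simp add: ln_ge_iff)
      then show "norm (92 / real n) \<le> 92 * norm (ln (real n) / real n)"
        using n by (simp add: field_simps)
    qed
    fix n :: nat assume n: "4 \<le> n"
    have "real n / 4 * (1 - 92 / real n) = real n / 4 - 23" using n by (simp add: field_simps)
    then show "ennreal (real n / 4 * (1 - 92 / real n)) \<le> idct (cycle_graph n)"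
      using idct_cycle_ge[OF n] by (simp only:)
  qed
  show "idct (cycle_graph n) \<le> ennreal ((real n - 1) / 4)" if "4 \<le> n" for n
    using that by (rule idct_cycle_le)
  show "(\<lambda>n. enn2real (idct (cycle_graph n))) \<sim>[sequentially] (\<lambda>n. real n / 4)"
    using tendsto_mult[OF tendsto_const[of "4::real"] idct_cycle_limit]
    by (intro asymp_equivI') (simp add: field_simps)
  have "(\<lambda>n. (enn2real (ict (cycle_graph n)) / real n) / (enn2real (idct (cycle_graph n)) / real n)) \<longlonglongrightarrow> (1 / 2) / (1 / 4)"
    by (intro tendsto_divide ict_cycle_limit idct_cycle_limit) simp
  then have "(\<lambda>n. ennreal ((enn2real (ict (cycle_graph n)) / real n) / (enn2real (idct (cycle_graph n)) / real n))) \<longlonglongrightarrow> 2"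
    using tendsto_ennrealI by fastforce
  then show "(\<lambda>n. cost_of_drunkenness (cycle_graph n)) \<longlonglongrightarrow> 2"
  proof (rule Lim_transform_eventually, intro eventually_mono[OF eventually_gt_at_top[of 92]])
    fix n :: nat assume n: "92 < n"
    let ?s = "enn2real (ict (cycle_graph n))" and ?r = "enn2real (idct (cycle_graph n))"
    \<comment> \<open>With both values finite and \<open>?r\<close> positive, division in
      \<open>ennreal\<close> agrees with division of reals.\<close>
    have "0 < ?r" using idct_cycle_bounds(2)[OF n] n by linarith
    then have "ennreal ?s / ennreal ?r = ennreal (?s / ?r)" by (simp add: divide_ennreal)
    then show "ennreal ((?s / real n) / (?r / real n)) = cost_of_drunkenness (cycle_graph n)"
      using n idct_cycle_bounds(1)[OF n] ict_cycle_bounds(1)[OF n]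
      by (simp add: cost_of_drunkenness_def)
  qed
qed

end
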